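(* Let $d\ge2$ and $0<q_0<p_c$. There exists a constant $K=K(q_0)>0$ such that for any $0<p<q\le q_0$ and any $\boldsymbol{x}\in\mathbb{R}^d$, \[ \mu_p(\boldsymbol{x})-\mu_q(\boldsymbol{x})\ \le\ \frac{K\,\mu_q(\boldsymbol{x})}{q}\,(q-p). \] In particular, for each $\boldsymbol{x}\in\mathbb{R}^d$, $p\mapsto\mu_p(\boldsymbol{x})$ is Lipschitz continuous on any closed subinterval $[p_0,q_0]$ of $(0,p_c)$.
   Context: Bernoulli first-passage percolation on the hypercubic lattice $\mathbb{L}^d=(\mathbb{Z}^d,\mathbb{E}^d)$, $d\ge2$: the passage times $\{t(e)\}_{e\in\mathbb{E}^d}$ are independent with $P_p(t(e)=0)=p$ and $P_p(t(e)=1)=1-p$; $E_p$ denotes expectation under $P_p$. For a self-avoiding lattice path $\gamma$, $t(\gamma)=\sum_{e\in\gamma}t(e)$. For $\boldsymbol{x}\in\mathbb{R}^d$ let $\boldsymbol{x}'$ be the unique point of $\mathbb{Z}^d$ with $\boldsymbol{x}\in\boldsymbol{x}'+[0,1)^d$, and define $T(\boldsymbol{x},\boldsymbol{y})=\inf_{\gamma:\boldsymbol{x}'\to\boldsymbol{y}'}t(\gamma)$ (infimum over self-avoiding paths from $\boldsymbol{x}'$ to $\boldsymbol{y}'$). With $\boldsymbol{O}$ the origin, the time constant is $\mu_p(\boldsymbol{x})=\lim_{n\to\infty}E_p[T(\boldsymbol{O},n\boldsymbol{x})]/n=\inf_{n\ge1}E_p[T(\boldsymbol{O},n\boldsymbol{x})]/n$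 for $\boldsymbol{x}\in\mathbb{Z}^d$, extended (as is known) to a seminorm on $\mathbb{R}^d$. $p_c=p_c(d)$ is the critical probability of bond percolation on $\mathbb{Z}^d$, i.e. the infimum of $p$ for which there exists an infinite self-avoiding path of edges with $t(e)=0$. *)

theory Defs
  imports "HOL-Probability.Probability" "HOL-Analysis.Analysis"
begin

text \<open>Vertices of Z^d are int^'n with d = CARD('n). The edge {u, u + e_i} is encoded
  uniquely as the pair (u, i).\<close>

type_synonym 'n edge = "(int^'n) \<times> 'n"

definition lat_adjacent :: "int^'n::finite \<Rightarrow> int^'n \<Rightarrow> bool" where
  "lat_adjacent u v \<longleftrightarrow> (\<exists>i. v = u + axis i 1 \<or> u = v + axis i 1)"

definition lat_edge :: "int^'n::finite \<Rightarrow> int^'n \<Rightarrow> 'n edge" where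
  "lat_edge u v = (if \<exists>i. v = u + axis i 1 then (u, (SOME i. v = u + axis i 1))
                  else (v, (SOME i. u = v + axis i 1)))"

definition passage_time :: "('n::finite edge \<Rightarrow> bool) \<Rightarrow> 'n edge \<Rightarrow> nat" where
  "passage_time \<omega> e = (if \<omega> e then 0 else 1)"

definition sa_paths :: "int^'n::finite \<Rightarrow> int^'n \<Rightarrow> (int^'n) list set" where
  "sa_paths x y = {\<gamma>. \<gamma> \<noteq> [] \<and> hd \<gamma> = x \<and> last \<gamma> = y \<and> distinct \<gamma> \<and> successively lat_adjacent \<gamma>}"

definition path_time :: "('n::finite edge \<Rightarrow> bool) \<Rightarrow> (int^'n) list \<Rightarrow> nat" where
  "path_time \<omega> \<gamma> = sum_list (map (\<lambda>(u, v). passage_time \<omega> (lat_edge u v)) (zip \<gamma> (tl \<gamma>)))"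

definition T_lat :: "('n::finite edge \<Rightarrow> bool) \<Rightarrow> int^'n \<Rightarrow> int^'n \<Rightarrow> nat" where
  "T_lat \<omega> x y = (INF \<gamma> \<in> sa_paths x y. path_time \<omega> \<gamma>)"

definition lattice_point :: "real^'n::finite \<Rightarrow> int^'n" where
  "lattice_point x = (\<chi> i. \<lfloor>x $ i\<rfloor>)"

definition passage :: "('n::finite edge \<Rightarrow> bool) \<Rightarrow> real^'n \<Rightarrow> real^'n \<Rightarrow> nat" where
  "passage \<omega> x y = T_lat \<omega> (lattice_point x) (lattice_point y)"

definition bfpp :: "real \<Rightarrow> ('n::finite edge \<Rightarrow> bool) measure" where
  "bfpp p = PiM UNIV (\<lambda>_. measure_pmf (bernoulli_pmf p))"

definition exp_passage :: "real \<Rightarrow> real^'n::finite \<Rightarrow> real" where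
  "exp_passage p x = integral\<^sup>L (bfpp p) (\<lambda>\<omega>. real (passage \<omega> 0 x))"

definition time_const :: "real \<Rightarrow> real^'n::finite \<Rightarrow> real" where
  "time_const p x = lim (\<lambda>n::nat. exp_passage p (real n *\<^sub>R x) / real n)"

definition perc_event :: "('n::finite edge \<Rightarrow> bool) set" where
  "perc_event = {\<omega>. \<exists>f :: nat \<Rightarrow> int^'n. inj f \<and>
      (\<forall>k. lat_adjacent (f k) (f (Suc k)) \<and> \<omega> (lat_edge (f k) (f (Suc k))))}"

definition p_crit :: "'n::finite itself \<Rightarrow> real" where
  "p_crit _ = Inf {p \<in> {0..1}. measure (bfpp p) (perc_event :: ('n edge \<Rightarrow> bool) set) > 0}"

end

theory Submission
  imports Defs
begin

text \<open>
  Thinning the open edges of parameter \<open>q\<close> with retention probability \<open>p/q\<close> gives parameter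
  \<open>p\<close>, and closes each edge of a fixed \<open>q\<close>-geodesic with probability at most \<open>(q - p)/q\<close>. So
  \<open>\<mu>\<^sub>p - \<mu>\<^sub>q\<close> is at most \<open>(q - p)/q\<close> times the length of geodesics per unit distance, and it
  suffices to bound the length of a geodesic by a constant multiple of its passage time, up to an
  error with bounded mean. If paths of \<open>m\<close> edges with few closed edges were not exponentially
  rare, then opening closed edges with a small probability would produce long open paths at some
  parameter strictly between \<open>q\<^sub>0\<close> and \<open>p\<^sub>c\<close> with a probability that decays too slowly.

  Exponential decay of the length of open paths below \<open>p\<^sub>c\<close> follows Duminil-Copin and Tassion. If
  some finite \<open>S\<close> containing the origin has \<open>p \<phi>\<^sub>p(S) < 1\<close>, where \<open>\<phi>\<^sub>p(S)\<close> is the expected number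
  of boundary edges reached inside \<open>S\<close>, then the van den Berg--Kesten inequality at the first exit
  from \<open>S\<close> gives exponential decay. If on a whole interval of parameters there is no such \<open>S\<close>,
  Russo's formula yields a differential inequality that forces percolation at its right end.
\<close>

section \<open>Product Bernoulli weights on a finite set\<close>

text \<open>What has to decay is the number of edges of an open self-avoiding path, not its extent:
  such a path can wind inside a ball of far smaller radius, and thinning acts on each of its edges.
  The first-exit argument suits lengths, because the stretch inside S visits at most
  \<open>card S\<close> vertices. Decay is used at a parameter strictly above q0, and the gap is the
  budget for opening closed edges. Opening a path of m edges with fewer than m/k closed ones costs a
  factor \<sigma>^m, where \<sigma>^k does not exceed the gap; decay at rate \<rho> = \<sigma>^2
  leaves \<sigma>^m. The resulting error bound does not depend on the endpoint, so it vanishes after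
  division by n. Independence, van den Berg--Kesten and Russo's formula are proved for
  \<open>config_exp\<close>, where a configuration is the finite set of its open edges: expectations
  are polynomials in p, and inductions remove one edge at a time.
  \<open>measure_bfpp_eq_config_exp\<close> transfers the results to the infinite product
  measure.\<close>

definition config_exp :: "real \<Rightarrow> 'e set \<Rightarrow> ('e set \<Rightarrow> real) \<Rightarrow> real" where
  "config_exp p E f = (\<Sum>A\<in>Pow E. p ^ card A * (1 - p) ^ card (E - A) * f A)"

lemma config_exp_empty [simp]: "config_exp p {} f = f {}"
  by (simp add: config_exp_def)

text \<open>Conditioning on the state of \<open>e\<close>, the engine of the inductions over the
  edge set. It is an identity for every real \<open>p\<close>, so it can be differentiated in
  \<open>p\<close>.\<close>

lemma config_exp_insert:
  assumes "finite E" "e \<notin> E"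
  shows "config_exp p (insert e E) f
    = config_exp p E (\<lambda>A. p * f (insert e A) + (1 - p) * f A)"
proof -
  have inj: "inj_on (insert e) (Pow E)"
    using assms(2) by (auto simp: inj_on_def)
  have "config_exp p (insert e E) f
     = (\<Sum>A\<in>Pow E. p ^ card A * (1 - p) ^ card (insert e E - A) * f A)
     + (\<Sum>A\<in>insert e ` Pow E. p ^ card A * (1 - p) ^ card (insert e E - A) * f A)"
    unfolding config_exp_def Pow_insert using assms by (intro sum.union_disjoint) auto
  also have "(\<Sum>A\<in>insert e ` Pow E. p ^ card A * (1 - p) ^ card (insert e E - A) * f A)
     = (\<Sum>A\<in>Pow E. p ^ card A * (1 - p) ^ card (E - A) * (p * f (insert e A)))"
    unfolding sum.reindex[OF inj] o_def
  proof (intro sum.cong refl)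
    fix A assume A: "A \<in> Pow E"
    then have "finite A" "e \<notin> A" using assms finite_subset by auto
    moreover have "insert e E - insert e A = E - A" using assms A by auto
    ultimately show "p ^ card (insert e A) * (1 - p) ^ card (insert e E - insert e A) * f (insert e A)
      = p ^ card A * (1 - p) ^ card (E - A) * (p * f (insert e A))" by simp
  qed
  also have "(\<Sum>A\<in>Pow E. p ^ card A * (1 - p) ^ card (insert e E - A) * f A)
     = (\<Sum>A\<in>Pow E. p ^ card A * (1 - p) ^ card (E - A) * ((1 - p) * f A))"
  proof (intro sum.cong refl)
    fix A assume A: "A \<in> Pow E"
    have "insert e E - A = insert e (E - A)" using assms A by auto
    then show "p ^ card A * (1 - p) ^ card (insert e E - A) * f A
      = p ^ card A * (1 - p) ^ card (E - A) * ((1 - p) * f A)" using assms by simp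
  qed
  finally show ?thesis
    by (simp add: config_exp_def distrib_left sum.distrib)
qed

lemma config_exp_cong:
  "(\<And>A. A \<subseteq> E \<Longrightarrow> f A = g A) \<Longrightarrow> config_exp p E f = config_exp p E g"
  by (auto simp: config_exp_def intro!: sum.cong)

lemma config_exp_add: "config_exp p E (\<lambda>A. f A + g A) = config_exp p E f + config_exp p E g"
  by (simp add: config_exp_def distrib_left sum.distrib)

lemma config_exp_diff: "config_exp p E (\<lambda>A. f A - g A) = config_exp p E f - config_exp p E g"
  by (simp add: config_exp_def right_diff_distrib sum_subtractf)

lemma config_exp_mult: "config_exp p E (\<lambda>A. c * f A) = c * config_exp p E f"
  by (simp add: config_exp_def sum_distrib_left mult.left_commute)

lemma config_exp_sum: "config_exp p E (\<lambda>A. \<Sum>i\<in>I. f i A) = (\<Sum>i\<in>I. config_exp p E (f i))"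
  unfolding config_exp_def sum_distrib_left by (rule sum.swap)

lemma config_exp_mono:
  assumes "0 \<le> p" "p \<le> 1" "\<And>A. A \<subseteq> E \<Longrightarrow> f A \<le> g A"
  shows "config_exp p E f \<le> config_exp p E g"
  unfolding config_exp_def using assms by (intro sum_mono mult_left_mono) auto

lemma config_exp_const: "finite E \<Longrightarrow> config_exp p E (\<lambda>A. c) = c"
  by (induction E rule: finite_induct)
    (simp_all add: config_exp_insert algebra_simps)

lemma config_exp_nonneg:
  assumes "0 \<le> p" "p \<le> 1" "\<And>A. A \<subseteq> E \<Longrightarrow> 0 \<le> f A"
  shows "0 \<le> config_exp p E f"
  unfolding config_exp_def using assms by (intro sum_nonneg mult_nonneg_nonneg) auto

text \<open>Independence of disjoint sets of edges. The edge split off in the induction lies on one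
  side of \<open>D\<close>, so the other factor ignores it and comes out of the average over its
  state. Both functions are generalized, because that average replaces one of them by a new function
  with the same locality.\<close>

lemma config_exp_indep:
  assumes "finite E" "\<And>A. A \<subseteq> E \<Longrightarrow> f A = f (A \<inter> D)" "\<And>A. A \<subseteq> E \<Longrightarrow> g A = g (A - D)"
  shows "config_exp p E (\<lambda>A. f A * g A) = config_exp p E f * config_exp p E g"
  using assms
proof (induction E arbitrary: f g rule: finite_induct)
  case (insert e E)
  have f: "f A = f (A \<inter> D)" if "A \<subseteq> insert e E" for A using insert.prems(1) that .
  have g: "g A = g (A - D)" if "A \<subseteq> insert e E" for A using insert.prems(2) that .
  note rec = config_exp_insert[OF insert.hyps(1,2)]
  show ?case
  proof (cases "e \<in> D")
    case True
    have ge: "g (insert e A) = g A" if "A \<subseteq> E" for A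
      using g[of "insert e A"] g[of A] that True by (simp add: insert_Diff_if subset_insertI2 insert_mono)
    have fe: "f (insert e A) = f (insert e (A \<inter> D))" if "A \<subseteq> E" for A
      using f[of "insert e A"] f[of "insert e (A \<inter> D)"] that True by (auto simp: Int_insert_left)
    let ?f = "\<lambda>A. p * f (insert e A) + (1 - p) * f A"
    have "config_exp p (insert e E) (\<lambda>A. f A * g A) = config_exp p E (\<lambda>A. ?f A * g A)"
      unfolding rec by (rule config_exp_cong) (simp add: ge algebra_simps)
    also have "\<dots> = config_exp p E ?f * config_exp p E g"
    proof (rule insert.IH)
      show "?f A = ?f (A \<inter> D)" if "A \<subseteq> E" for A using fe[OF that] f[of A] that by auto
      show "g A = g (A - D)" if "A \<subseteq> E" for A using g that by auto
    qed
    also have "config_exp p E g = config_exp p (insert e E) g"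
      unfolding rec by (rule config_exp_cong) (simp add: ge algebra_simps)
    finally show ?thesis unfolding rec .
  next
    case False
    have fe: "f (insert e A) = f A" if "A \<subseteq> E" for A
      using f[of "insert e A"] f[of A] that False by (simp add: Int_insert_left subset_insertI2 insert_mono)
    have ge: "g (insert e A) = g (insert e (A - D))" if "A \<subseteq> E" for A
      using g[of "insert e A"] g[of "insert e (A - D)"] that False
      by (auto simp: insert_Diff_if)
    let ?g = "\<lambda>A. p * g (insert e A) + (1 - p) * g A"
    have "config_exp p (insert e E) (\<lambda>A. f A * g A) = config_exp p E (\<lambda>A. f A * ?g A)"
      unfolding rec by (rule config_exp_cong) (simp add: fe algebra_simps)
    also have "\<dots> = config_exp p E f * config_exp p E ?g"
    proof (rule insert.IH)
      show "?g A = ?g (A - D)" if "A \<subseteq> E" for A using ge[OF that] g[of A] that by auto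
      show "f A = f (A \<inter> D)" if "A \<subseteq> E" for A using f that by auto
    qed
    also have "config_exp p E f = config_exp p (insert e E) f"
      unfolding rec by (rule config_exp_cong) (simp add: fe algebra_simps)
    finally show ?thesis unfolding rec .
  qed
qed simp

lemma config_exp_member:
  assumes "finite E" "e \<in> E"
  shows "config_exp p E (\<lambda>A. of_bool (e \<in> A)) = p"
proof -
  have "config_exp p (insert e (E - {e})) (\<lambda>A. of_bool (e \<in> A)) = config_exp p (E - {e}) (\<lambda>A. p)"
    using assms by (subst config_exp_insert) (auto intro!: config_exp_cong)
  then show ?thesis using assms by (simp add: config_exp_const insert_absorb)
qed

text \<open>Van den Berg--Kesten for increasing events. Stating it for a monotone relation
  between the two witnesses, rather than a product of two events, makes the induction close.\<close>

lemma config_exp_disjoint_occurrence_aux: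
  fixes c :: "'e set \<Rightarrow> 'e set \<Rightarrow> bool"
  assumes "finite E" "0 \<le> p" "p \<le> 1"
    and "\<And>A B A' B'. c A B \<Longrightarrow> A \<subseteq> A' \<Longrightarrow> B \<subseteq> B' \<Longrightarrow> c A' B'"
  shows "config_exp p E (\<lambda>A. of_bool (\<exists>B\<subseteq>A. c B (A - B)))
    \<le> config_exp p E (\<lambda>A. config_exp p E (\<lambda>B. of_bool (c A B)))"
  using assms(1,4)
proof (induction E arbitrary: c rule: finite_induct)
  case (insert e E)
  note rec = config_exp_insert[OF insert.hyps(1,2)]
  note mono = insert.prems
  \<comment> \<open>An open \<open>e\<close> can be handed to only one of the two witnesses;
    \<open>c'\<close> is the relation that is then left for the remaining edges.\<close>
  define c' where "c' A B \<longleftrightarrow> c (insert e A) B \<or> c A (insert e B)" for A B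
  have mono': "c' A' B'" if "c' A B" "A \<subseteq> A'" "B \<subseteq> B'" for A B A' B'
    using that(1) mono[of "insert e A" B "insert e A'" B'] mono[of A "insert e B" A' "insert e B'"] that(2,3)
    unfolding c'_def by blast
  have split: "(\<exists>B\<subseteq>insert e A. c B (insert e A - B)) \<longleftrightarrow> (\<exists>B\<subseteq>A. c' B (A - B))" if "A \<subseteq> E" for A
  proof
    assume "\<exists>B\<subseteq>insert e A. c B (insert e A - B)"
    then obtain B where B: "B \<subseteq> insert e A" "c B (insert e A - B)" by blast
    have eA: "e \<notin> A" using that insert.hyps(2) by auto
    show "\<exists>B\<subseteq>A. c' B (A - B)"
    proof (cases "e \<in> B")
      case True
      then have "insert e (B - {e}) = B" "insert e A - B = A - (B - {e})" "B - {e} \<subseteq> A"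
        using B(1) eA by auto
      with B(2) show ?thesis unfolding c'_def by metis
    next
      case False
      then have "insert e A - B = insert e (A - B)" "B \<subseteq> A" using B(1) by auto
      with B(2) show ?thesis unfolding c'_def by metis
    qed
  next
    assume "\<exists>B\<subseteq>A. c' B (A - B)"
    then obtain B where B: "B \<subseteq> A" "c' B (A - B)" by blast
    have eA: "e \<notin> A" using that insert.hyps(2) by auto
    from B(2) consider "c (insert e B) (A - B)" | "c B (insert e (A - B))" unfolding c'_def by blast
    then show "\<exists>B\<subseteq>insert e A. c B (insert e A - B)"
    proof cases
      case 1
      moreover have "insert e A - insert e B = A - B" using eA by auto
      ultimately show ?thesis using B(1) by (intro exI[of _ "insert e B"]) auto
    next
      case 2
      moreover have "insert e A - B = insert e (A - B)" using B(1) eA by auto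
      ultimately show ?thesis using B(1) by (intro exI[of _ B]) auto
    qed
  qed
  have "config_exp p (insert e E) (\<lambda>A. of_bool (\<exists>B\<subseteq>A. c B (A - B)))
     = p * config_exp p E (\<lambda>A. of_bool (\<exists>B\<subseteq>A. c' B (A - B)))
       + (1 - p) * config_exp p E (\<lambda>A. of_bool (\<exists>B\<subseteq>A. c B (A - B)))"
    unfolding rec config_exp_add[symmetric] config_exp_mult[symmetric]
    by (rule config_exp_cong) (simp add: split)
  also have "\<dots> \<le> p * config_exp p E (\<lambda>A. config_exp p E (\<lambda>B. of_bool (c' A B)))
       + (1 - p) * config_exp p E (\<lambda>A. config_exp p E (\<lambda>B. of_bool (c A B)))"
    using assms(2,3) insert.IH[of c', OF mono'] insert.IH[of c, OF mono]
    by (intro add_mono mult_left_mono) auto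
  also have "\<dots> = config_exp p E (\<lambda>A. config_exp p E
      (\<lambda>B. p * of_bool (c' A B) + (1 - p) * of_bool (c A B)))"
    by (simp add: config_exp_add config_exp_mult)
  \<comment> \<open>One copy of \<open>e\<close>, usable by either side, is replaced by two
    independent copies. If exactly one side can use \<open>e\<close>, both expressions equal p. If
    either side can, the right one is larger by p(1 - p), unless \<open>c A B\<close> holds already
    and both are 1.\<close>
  also have "\<dots> \<le> config_exp p E (\<lambda>A. config_exp p E
      (\<lambda>B. p * (p * of_bool (c (insert e A) (insert e B)) + (1 - p) * of_bool (c (insert e A) B))
        + (1 - p) * (p * of_bool (c A (insert e B)) + (1 - p) * of_bool (c A B))))"
  proof (intro config_exp_mono assms(2,3))
    fix A B :: "'e set"
    have m: "c A B \<Longrightarrow> c (insert e A) B" "c A B \<Longrightarrow> c A (insert e B)"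
      "c (insert e A) B \<Longrightarrow> c (insert e A) (insert e B)"
      "c A (insert e B) \<Longrightarrow> c (insert e A) (insert e B)"
      using mono by blast+
    have pp: "0 \<le> p * (1 - p)" using assms(2,3) by simp
    show "p * of_bool (c' A B) + (1 - p) * of_bool (c A B) \<le>
       p * (p * of_bool (c (insert e A) (insert e B)) + (1 - p) * of_bool (c (insert e A) B))
        + (1 - p) * (p * of_bool (c A (insert e B)) + (1 - p) * of_bool (c A B))"
      using m pp assms(2) unfolding c'_def
      by (cases "c A B"; cases "c (insert e A) B"; cases "c A (insert e B)";
          cases "c (insert e A) (insert e B)") (auto simp: algebra_simps)
  qed
  also have "\<dots> = config_exp p (insert e E) (\<lambda>A. config_exp p (insert e E) (\<lambda>B. of_bool (c A B)))"
    unfolding rec by (simp add: config_exp_add config_exp_mult)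
  finally show ?case .
qed simp

lemma config_exp_disjoint_occurrence:
  assumes "finite E" "0 \<le> p" "p \<le> 1"
    and "\<And>A A'. P A \<Longrightarrow> A \<subseteq> A' \<Longrightarrow> P A'" and "\<And>A A'. Q A \<Longrightarrow> A \<subseteq> A' \<Longrightarrow> Q A'"
  shows "config_exp p E (\<lambda>A. of_bool (\<exists>B\<subseteq>A. P B \<and> Q (A - B)))
    \<le> config_exp p E (\<lambda>A. of_bool (P A)) * config_exp p E (\<lambda>A. of_bool (Q A))"
proof -
  have "config_exp p E (\<lambda>A. of_bool (\<exists>B\<subseteq>A. P B \<and> Q (A - B)))
     \<le> config_exp p E (\<lambda>A. config_exp p E (\<lambda>B. of_bool (P A \<and> Q B)))"
    using assms(4,5)
    by (intro config_exp_disjoint_occurrence_aux assms(1-3)) blast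
  also have "\<dots> = config_exp p E (\<lambda>A. of_bool (P A) * config_exp p E (\<lambda>B. of_bool (Q B)))"
    by (simp only: of_bool_conj config_exp_mult)
  also have "\<dots> = config_exp p E (\<lambda>A. of_bool (P A)) * config_exp p E (\<lambda>A. of_bool (Q A))"
    by (subst mult.commute) (simp only: config_exp_mult, simp)
  finally show ?thesis .
qed

text \<open>Russo's formula for an arbitrary function. With \<open>e\<close> split off, the
  expectation is p F1(p) + (1 - p) F0(p), where F1 and F0 are expectations over the smaller set with
  \<open>e\<close> open and closed. The product rule yields the summand of \<open>e\<close>, the
  induction hypothesis the others.\<close>

lemma config_exp_has_derivative:
  assumes "finite E"
  shows "((\<lambda>p. config_exp p E f) has_real_derivative
    (\<Sum>e\<in>E. config_exp p E (\<lambda>A. f (insert e A) - f (A - {e})))) (at p)"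
  using assms
proof (induction E arbitrary: f rule: finite_induct)
  case (insert e E)
  note rec = config_exp_insert[OF insert.hyps(1,2)]
  let ?D = "\<lambda>f. \<Sum>e\<in>E. config_exp p E (\<lambda>A. f (insert e A) - f (A - {e}))"
  let ?f = "\<lambda>A. f (insert e A)"
  have "((\<lambda>p. p * config_exp p E ?f + (1 - p) * config_exp p E f) has_real_derivative
     (config_exp p E ?f - config_exp p E f + (p * ?D ?f + (1 - p) * ?D f))) (at p)"
    by (rule derivative_eq_intros insert.IH refl | simp)+
  moreover have "(\<lambda>p. p * config_exp p E ?f + (1 - p) * config_exp p E f)
      = (\<lambda>p. config_exp p (insert e E) f)"
    unfolding rec by (simp add: config_exp_add config_exp_mult)
  moreover have "config_exp p (insert e E) (\<lambda>A. f (insert e A) - f (A - {e}))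
      = config_exp p E ?f - config_exp p E f"
  proof -
    have "config_exp p (insert e E) (\<lambda>A. f (insert e A) - f (A - {e}))
      = config_exp p E (\<lambda>A. ?f A - f A)"
      unfolding rec
    proof (rule config_exp_cong)
      fix A assume "A \<subseteq> E"
      then have "A - {e} = A" using insert.hyps(2) by auto
      then show "p * (f (insert e (insert e A)) - f (insert e A - {e}))
         + (1 - p) * (f (insert e A) - f (A - {e})) = f (insert e A) - f A"
        by (simp add: algebra_simps)
    qed
    then show ?thesis by (simp add: config_exp_diff)
  qed
  moreover have "(\<Sum>a\<in>E. config_exp p (insert e E) (\<lambda>A. f (insert a A) - f (A - {a})))
     = p * ?D ?f + (1 - p) * ?D f"
    unfolding sum_distrib_left sum.distrib[symmetric]
  proof (rule sum.cong[OF refl])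
    fix a assume "a \<in> E"
    then have "insert e A - {a} = insert e (A - {a})" for A using insert.hyps(2) by auto
    then show "config_exp p (insert e E) (\<lambda>A. f (insert a A) - f (A - {a}))
      = p * config_exp p E (\<lambda>A. ?f (insert a A) - ?f (A - {a}))
        + (1 - p) * config_exp p E (\<lambda>A. f (insert a A) - f (A - {a}))"
      unfolding rec by (simp add: config_exp_add config_exp_mult insert_commute)
  qed
  ultimately show ?case
    unfolding sum.insert[OF insert.hyps(1,2)] by (simp only: add_ac diff_conv_add_uminus)
qed simp

text \<open>Whether \<open>e\<close> is pivotal does not depend on the state of \<open>e\<close>, so
  the factor 1 - p restricts the count to closed pivotal edges. This is the form needed later, since
  the edges leaving the trapped set are closed.\<close>

lemma config_exp_decreasing_derivative:
  assumes "finite E" "\<And>A A'. P A' \<Longrightarrow> A \<subseteq> A' \<Longrightarrow> P A"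
    and d: "((\<lambda>p. config_exp p E (\<lambda>A. of_bool (P A))) has_real_derivative d) (at p)"
  shows "(1 - p) * d = - config_exp p E (\<lambda>A. real (card {e\<in>E. e \<notin> A \<and> P A \<and> \<not> P (insert e A)}))"
proof -
  \<comment> \<open>\<open>P\<close> is evaluated with \<open>e\<close> removed and with
    \<open>e\<close> inserted, so \<open>piv e A\<close> ignores the state of \<open>e\<close>; its
    independence of \<open>e \<notin> A\<close> rests on this.\<close>
  define piv :: "'a \<Rightarrow> 'a set \<Rightarrow> real"
    where "piv e A = of_bool (P (A - {e}) \<and> \<not> P (insert e A))" for e A
  have "d = (\<Sum>e\<in>E. config_exp p E (\<lambda>A. of_bool (P (insert e A)) - of_bool (P (A - {e}))))"
    using DERIV_unique[OF d config_exp_has_derivative[OF assms(1)]] .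
  also have "\<dots> = (\<Sum>e\<in>E. config_exp p E (\<lambda>A. (-1) * piv e A))"
  proof (intro sum.cong refl config_exp_cong)
    fix e A
    have "P (insert e A) \<Longrightarrow> P (A - {e})" by (erule assms(2)) auto
    then show "of_bool (P (insert e A)) - of_bool (P (A - {e})) = (-1) * piv e A"
      by (auto simp: piv_def)
  qed
  also have "\<dots> = - (\<Sum>e\<in>E. config_exp p E (piv e))"
    by (simp only: config_exp_mult sum_distrib_left[symmetric])
  finally have "(1 - p) * d = - (\<Sum>e\<in>E. (1 - p) * config_exp p E (piv e))"
    by (simp add: sum_distrib_left)
  also have "(\<Sum>e\<in>E. (1 - p) * config_exp p E (piv e))
      = (\<Sum>e\<in>E. config_exp p E (\<lambda>A. of_bool (e \<notin> A \<and> P A \<and> \<not> P (insert e A))))"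
  proof (intro sum.cong refl)
    fix e assume e: "e \<in> E"
    have "config_exp p E (\<lambda>A. of_bool (e \<notin> A) * piv e A)
      = config_exp p E (\<lambda>A. of_bool (e \<notin> A)) * config_exp p E (piv e)"
      by (rule config_exp_indep[OF assms(1), where D = "{e}"]) (auto simp: piv_def insert_absorb)
    also have "config_exp p E (\<lambda>A. of_bool (e \<notin> A)) = 1 - p"
      using config_exp_diff[of p E "\<lambda>A. 1" "\<lambda>A. of_bool (e \<in> A)"] assms(1) e
      by (simp add: config_exp_member config_exp_const of_bool_not_iff)
    also have "config_exp p E (\<lambda>A. of_bool (e \<notin> A) * piv e A)
      = config_exp p E (\<lambda>A. of_bool (e \<notin> A \<and> P A \<and> \<not> P (insert e A)))"
    proof (rule config_exp_cong)
      fix A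
      show "of_bool (e \<notin> A) * piv e A = of_bool (e \<notin> A \<and> P A \<and> \<not> P (insert e A))"
        by (cases "e \<in> A") (simp_all add: piv_def)
    qed
    finally show "(1 - p) * config_exp p E (piv e)
      = config_exp p E (\<lambda>A. of_bool (e \<notin> A \<and> P A \<and> \<not> P (insert e A)))" by simp
  qed
  also have "\<dots> = config_exp p E (\<lambda>A. \<Sum>e\<in>E. of_bool (e \<notin> A \<and> P A \<and> \<not> P (insert e A)))"
    by (rule config_exp_sum[symmetric])
  also have "\<dots> = config_exp p E (\<lambda>A. real (card {e\<in>E. e \<notin> A \<and> P A \<and> \<not> P (insert e A)}))"
    using assms(1) by (intro config_exp_cong) (simp add: of_bool_def sum.If_cases Int_def conj_commute)
  finally show ?thesis .
qed

section \<open>The Bernoulli product measure and its couplings\<close>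

lemma prob_space_bfpp: "prob_space (bfpp p)"
  unfolding bfpp_def by (intro prob_space_PiM measure_pmf.prob_space_axioms)

interpretation bfpp: prob_space "bfpp p" for p
  by (rule prob_space_bfpp)

lemma space_bfpp [simp]: "space (bfpp p) = UNIV"
  by (simp add: bfpp_def space_PiM)

lemma measurable_bfpp_component [measurable]: "(\<lambda>\<omega>. \<omega> e) \<in> measurable (bfpp p) (count_space UNIV)"
proof -
  have "(\<lambda>\<omega>. \<omega> e) \<in> measurable (bfpp p) (measure_pmf (bernoulli_pmf p))"
    unfolding bfpp_def by (rule measurable_component_singleton) simp
  then show ?thesis by simp
qed

lemma measurable_into_bfpp:
  assumes "\<And>e. (\<lambda>x. f x e) \<in> measurable M (count_space UNIV)"
  shows "f \<in> measurable M (bfpp p)"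
  unfolding bfpp_def using assms
  by (intro measurable_PiM_single') (auto simp: measurable_def)

lemma emeasure_bfpp_cylinder:
  assumes "finite J"
  shows "emeasure (bfpp p) {\<omega>. \<forall>e\<in>J. \<omega> e \<in> X e} = (\<Prod>e\<in>J. emeasure (measure_pmf (bernoulli_pmf p)) (X e))"
proof -
  let ?M = "\<lambda>_. measure_pmf (bernoulli_pmf p)"
  have "{\<omega>. \<forall>e\<in>J. \<omega> e \<in> X e} = prod_emb UNIV ?M J (Pi\<^sub>E J X)"
    by (auto simp: prod_emb_def PiE_iff)
  then show ?thesis
    unfolding bfpp_def using assms
    by (simp add: emeasure_PiM_emb measure_pmf.prob_space_axioms)
qed

lemma nn_integral_bfpp_prod:
  assumes "finite J"
  shows "(\<integral>\<^sup>+\<omega>. (\<Prod>e\<in>J. f e (\<omega> e)) \<partial>bfpp p)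
    = (\<Prod>e\<in>J. \<integral>\<^sup>+b. f e b \<partial>measure_pmf (bernoulli_pmf p))"
proof -
  let ?M = "\<lambda>_::('a::finite) edge. measure_pmf (bernoulli_pmf p)"
  interpret P: product_prob_space ?M UNIV by unfold_locales
  have "(\<integral>\<^sup>+\<omega>. (\<Prod>e\<in>J. f e (\<omega> e)) \<partial>PiM UNIV ?M)
      = (\<integral>\<^sup>+\<omega>. (\<Prod>e\<in>J. f e (restrict \<omega> J e)) \<partial>PiM UNIV ?M)"
    by (intro nn_integral_cong prod.cong) auto
  also have "\<dots> = (\<integral>\<^sup>+\<omega>. (\<Prod>e\<in>J. f e (\<omega> e)) \<partial>distr (PiM UNIV ?M) (PiM J ?M) (\<lambda>x. restrict x J))"
    by (subst nn_integral_distr) (auto intro!: measurable_restrict_subset borel_measurable_prod_ennreal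
      measurable_compose[OF measurable_component_singleton])
  also have "\<dots> = (\<integral>\<^sup>+\<omega>. (\<Prod>e\<in>J. f e (\<omega> e)) \<partial>PiM J ?M)"
    using assms by (subst P.distr_PiM_restrict_finite) auto
  also have "\<dots> = (\<Prod>e\<in>J. \<integral>\<^sup>+b. f e b \<partial>measure_pmf (bernoulli_pmf p))"
    using assms by (intro P.product_nn_integral_prod) auto
  finally show ?thesis by (simp add: bfpp_def)
qed

lemma sets_bfpp_component: "{\<omega>. \<omega> e = b} \<in> sets (bfpp p)"
  using measurable_sets[OF measurable_bfpp_component[of e p], of "{b}"] by (simp add: vimage_def)

lemma sets_bfpp_finite:
  fixes E :: "('n::finite) edge set"
  assumes "finite E"
  shows "{\<omega>. Q {e\<in>E. \<omega> e}} \<in> sets (bfpp p)"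
proof -
  have "{\<omega>\<in>space (bfpp p). \<forall>e\<in>E. \<omega> e = (e \<in> A)} \<in> sets (bfpp p)" for A
    using assms by (intro sets.sets_Collect_finite_All) (simp_all add: sets_bfpp_component)
  then have "(\<Union>A\<in>{A\<in>Pow E. Q A}. {\<omega>. \<forall>e\<in>E. \<omega> e = (e \<in> A)}) \<in> sets (bfpp p)"
    using assms by (intro sets.finite_UN) auto
  also have "(\<Union>A\<in>{A\<in>Pow E. Q A}. {\<omega>. \<forall>e\<in>E. \<omega> e = (e \<in> A)})
      = (\<Union>A\<in>{A\<in>Pow E. Q A}. {\<omega>. {e\<in>E. \<omega> e} = A})"
    by (intro SUP_cong refl) auto
  also have "\<dots> = {\<omega>. Q {e\<in>E. \<omega> e}}" by auto
  finally show ?thesis .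
qed

lemma local_event_eq:
  assumes "\<And>A. Q A = Q (A \<inter> E)"
  shows "{\<omega>. Q {e. \<omega> e}} = {\<omega>. Q {e\<in>E. \<omega> e}}"
proof -
  have "Q {e. \<omega> e} = Q {e\<in>E. \<omega> e}" for \<omega>
    using assms[of "{e. \<omega> e}"] by (simp add: Int_def conj_commute)
  then show ?thesis by simp
qed

text \<open>The event splits into finitely many cylinders, each prescribing the trace on
  \<open>E\<close>, and every cylinder has the weight of one summand of
  \<open>config_exp\<close>.\<close>

lemma measure_bfpp_eq_config_exp:
  fixes E :: "('n::finite) edge set"
  assumes "finite E" "0 \<le> p" "p \<le> 1"
  shows "measure (bfpp p) {\<omega>. Q {e\<in>E. \<omega> e}} = config_exp p E (\<lambda>A. of_bool (Q A))"
proof -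
  let ?C = "\<lambda>A. {\<omega>. \<forall>e\<in>E. \<omega> e \<in> {e \<in> A}}"
  have C: "?C A = {\<omega>. {e\<in>E. \<omega> e} = A}" if "A \<in> Pow E" for A using that by auto
  have sets: "?C A \<in> sets (bfpp p)" for A
    using sets_bfpp_finite[OF assms(1), of "\<lambda>B. \<forall>e\<in>E. (e \<in> B) = (e \<in> A)" p] by (simp cong: ball_cong)
  have m: "measure (bfpp p) (?C A) = p ^ card A * (1 - p) ^ card (E - A)" if "A \<in> Pow E" for A
  proof -
    have "emeasure (bfpp p) (?C A) = (\<Prod>e\<in>E. emeasure (measure_pmf (bernoulli_pmf p)) {e \<in> A})"
      by (rule emeasure_bfpp_cylinder[OF assms(1)])
    also have "\<dots> = (\<Prod>e\<in>E. ennreal (if e \<in> A then p else 1 - p))"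
      using assms(2,3) by (intro prod.cong refl) (auto simp: emeasure_pmf_single)
    also have "\<dots> = ennreal (\<Prod>e\<in>E. if e \<in> A then p else 1 - p)"
      using assms by (intro prod_ennreal) auto
    also have "(\<Prod>e\<in>E. if e \<in> A then p else 1 - p) = p ^ card A * (1 - p) ^ card (E - A)"
    proof -
      have "E \<inter> A = A" "E \<inter> {e. e \<in> A} = A" "E \<inter> - {e. e \<in> A} = E - A" using that by auto
      then show ?thesis using assms(1) by (simp add: prod.If_cases)
    qed
    finally show ?thesis using assms by (simp add: measure_def)
  qed
  have "(\<Union>A\<in>{A\<in>Pow E. Q A}. ?C A) = (\<Union>A\<in>{A\<in>Pow E. Q A}. {\<omega>. {e\<in>E. \<omega> e} = A})"
    by (intro SUP_cong refl C) auto
  also have "\<dots> = {\<omega>. Q {e\<in>E. \<omega> e}}" by auto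
  finally have "{\<omega>. Q {e\<in>E. \<omega> e}} = (\<Union>A\<in>{A\<in>Pow E. Q A}. ?C A)" ..
  moreover have disj: "disjoint_family_on ?C {A\<in>Pow E. Q A}"
    unfolding disjoint_family_on_def by blast
  moreover have fin: "finite {A\<in>Pow E. Q A}" using assms(1) by simp
  moreover have im: "?C ` {A\<in>Pow E. Q A} \<subseteq> sets (bfpp p)" using sets by blast
  ultimately have "measure (bfpp p) {\<omega>. Q {e\<in>E. \<omega> e}}
      = (\<Sum>A\<in>{A\<in>Pow E. Q A}. measure (bfpp p) (?C A))"
    using bfpp.finite_measure_finite_Union[OF fin im disj] by (simp only:)
  also have "\<dots> = (\<Sum>A\<in>{A\<in>Pow E. Q A}. p ^ card A * (1 - p) ^ card (E - A))"
    by (rule sum.cong[OF refl], rule m) simp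
  also have "\<dots> = config_exp p E (\<lambda>A. of_bool (Q A))"
    unfolding config_exp_def
    by (rule sum.mono_neutral_cong_left) (use assms(1) in \<open>auto simp: of_bool_def\<close>)
  finally show ?thesis .
qed

lemma measure_bfpp_local_eq_config_exp:
  fixes E :: "('n::finite) edge set"
  assumes "finite E" "0 \<le> p" "p \<le> 1" "\<And>A. Q A = Q (A \<inter> E)"
  shows "measure (bfpp p) {\<omega>. Q {e. \<omega> e}} = config_exp p E (\<lambda>A. of_bool (Q A))"
  unfolding local_event_eq[of Q E, OF assms(4)] by (rule measure_bfpp_eq_config_exp[OF assms(1-3)])

text \<open>If h X Y has the one-edge law of parameter c for independent X and Y of parameters a and
  b, then \<open>h\<close> applied edge by edge turns two independent configurations into one of
  parameter c: the laws agree on cylinders, where everything factors over edges. Conjunction gives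
  thinning, disjunction the opening of closed edges. The iterated integral makes it possible to
  bound the inner expectation for each fixed \<omega>.\<close>

lemma nn_integral_bfpp_coupling:
  fixes f :: "(('n::finite) edge \<Rightarrow> bool) \<Rightarrow> ennreal"
  assumes h: "bernoulli_pmf c = bind_pmf (bernoulli_pmf a) (\<lambda>x. map_pmf (h x) (bernoulli_pmf b))"
    and f: "f \<in> borel_measurable (bfpp c)"
  shows "(\<integral>\<^sup>+\<omega>. f \<omega> \<partial>bfpp c) = (\<integral>\<^sup>+\<omega>. \<integral>\<^sup>+\<eta>. f (\<lambda>e. h (\<omega> e) (\<eta> e)) \<partial>bfpp b \<partial>bfpp a)"
proof -
  let ?B = "\<lambda>c. measure_pmf (bernoulli_pmf c)"
  let ?H = "\<lambda>(\<omega>, \<eta>) (e :: 'n edge). h (\<omega> e) (\<eta> e)"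
  let ?D = "distr (bfpp a \<Otimes>\<^sub>M bfpp b) (bfpp c) ?H"
  have H: "?H \<in> measurable (bfpp a \<Otimes>\<^sub>M bfpp b) (bfpp c)"
  proof (rule measurable_into_bfpp)
    fix e :: "'n edge"
    have [measurable]: "(\<lambda>x. fst x e) \<in> measurable (bfpp a \<Otimes>\<^sub>M bfpp b) (count_space UNIV)"
      "(\<lambda>x. snd x e) \<in> measurable (bfpp a \<Otimes>\<^sub>M bfpp b) (count_space UNIV)"
      by (rule measurable_compose[OF measurable_fst measurable_bfpp_component]
          measurable_compose[OF measurable_snd measurable_bfpp_component])+
    \<comment> \<open>Listing the four values of \<open>h\<close> makes measurability visible for an
      arbitrary \<open>h\<close>.\<close>
    have "(\<lambda>x. ?H x e) = (\<lambda>x. if fst x e then (if snd x e then h True True else h True False)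
        else (if snd x e then h False True else h False False))"
      by (auto simp: fun_eq_iff)
    also have "\<dots> \<in> measurable (bfpp a \<Otimes>\<^sub>M bfpp b) (count_space UNIV)" by measurable
    finally show "(\<lambda>x. ?H x e) \<in> measurable (bfpp a \<Otimes>\<^sub>M bfpp b) (count_space UNIV)" .
  qed
  interpret C: product_prob_space "\<lambda>_. ?B c" UNIV by unfold_locales
  have "?D = bfpp c"
    unfolding bfpp_def[of c]
  proof (rule C.PiM_eq)
    show "sets (distr (bfpp a \<Otimes>\<^sub>M bfpp b) (PiM UNIV (\<lambda>_. ?B c)) ?H) = sets (PiM UNIV (\<lambda>_. ?B c))"
      by simp
    fix J :: "'n edge set" and F :: "'n edge \<Rightarrow> bool set" assume J: "finite J"
    let ?X = "prod_emb UNIV (\<lambda>_. ?B c) J (Pi\<^sub>E J F)"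
    have X: "?X = {\<omega>. \<forall>e\<in>J. \<omega> e \<in> F e}" by (auto simp: prod_emb_def PiE_iff)
    have X_sets: "?X \<in> sets (PiM UNIV (\<lambda>_. ?B c))" using J by (intro sets_PiM_I) auto
    have "emeasure (distr (bfpp a \<Otimes>\<^sub>M bfpp b) (PiM UNIV (\<lambda>_. ?B c)) ?H) ?X
      = emeasure (bfpp a \<Otimes>\<^sub>M bfpp b) (?H -` ?X \<inter> space (bfpp a \<Otimes>\<^sub>M bfpp b))"
      using H X_sets by (intro emeasure_distr) (auto simp: bfpp_def)
    also have "\<dots> = (\<integral>\<^sup>+\<omega>. emeasure (bfpp b) (Pair \<omega> -` (?H -` ?X \<inter> space (bfpp a \<Otimes>\<^sub>M bfpp b))) \<partial>bfpp a)"
      using H X_sets by (intro bfpp.emeasure_pair_measure_alt measurable_sets[of _ _ "bfpp c"]) (auto simp: bfpp_def)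
    also have "\<dots> = (\<integral>\<^sup>+\<omega>. emeasure (bfpp b) {\<eta>. \<forall>e\<in>J. \<eta> e \<in> {y. h (\<omega> e) y \<in> F e}} \<partial>bfpp a)"
      by (intro nn_integral_cong arg_cong[where f = "emeasure (bfpp b)"])
        (auto simp: X space_pair_measure)
    also have "\<dots> = (\<integral>\<^sup>+\<omega>. (\<Prod>e\<in>J. emeasure (?B b) {y. h (\<omega> e) y \<in> F e}) \<partial>bfpp a)"
      by (simp only: emeasure_bfpp_cylinder[OF J])
    also have "\<dots> = (\<Prod>e\<in>J. \<integral>\<^sup>+x. emeasure (?B b) {y. h x y \<in> F e} \<partial>?B a)"
      by (rule nn_integral_bfpp_prod[OF J])
    also have "\<dots> = (\<Prod>e\<in>J. emeasure (?B c) (F e))"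
      unfolding h emeasure_bind_pmf by (simp add: vimage_def)
    finally show "emeasure (distr (bfpp a \<Otimes>\<^sub>M bfpp b) (PiM UNIV (\<lambda>_. ?B c)) ?H) ?X
      = (\<Prod>e\<in>J. emeasure (?B c) (F e))" .
  qed
  then have "(\<integral>\<^sup>+\<omega>. f \<omega> \<partial>bfpp c) = (\<integral>\<^sup>+\<omega>. f \<omega> \<partial>?D)" by simp
  also have "\<dots> = (\<integral>\<^sup>+x. f (?H x) \<partial>(bfpp a \<Otimes>\<^sub>M bfpp b))"
    using f by (intro nn_integral_distr[OF H]) simp
  also have "\<dots> = (\<integral>\<^sup>+\<omega>. \<integral>\<^sup>+\<eta>. f (?H (\<omega>, \<eta>)) \<partial>bfpp b \<partial>bfpp a)"
    using measurable_compose[OF H f] by (intro bfpp.nn_integral_fst[symmetric])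
  finally show ?thesis by simp
qed

lemma bernoulli_pmf_conj:
  assumes "0 \<le> a" "a \<le> 1" "0 \<le> b" "b \<le> 1"
  shows "bernoulli_pmf (a * b) = bind_pmf (bernoulli_pmf a) (\<lambda>x. map_pmf ((\<and>) x) (bernoulli_pmf b))"
proof (rule pmf_eqI)
  fix i
  have ab: "0 \<le> a * b" "a * b \<le> 1" using assms by (auto intro: mult_le_one)
  have [simp]: "(\<and>) True = (\<lambda>x. x)" "(\<and>) False = (\<lambda>x. False)" by (auto simp: fun_eq_iff)
  show "pmf (bernoulli_pmf (a * b)) i
      = pmf (bind_pmf (bernoulli_pmf a) (\<lambda>x. map_pmf ((\<and>) x) (bernoulli_pmf b))) i"
    using assms ab by (cases i) (simp_all add: pmf_bind map_pmf_const algebra_simps)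
qed

lemma bernoulli_pmf_disj:
  assumes "0 \<le> a" "a \<le> 1" "0 \<le> b" "b \<le> 1"
  shows "bernoulli_pmf (a + (1 - a) * b)
    = bind_pmf (bernoulli_pmf a) (\<lambda>x. map_pmf ((\<or>) x) (bernoulli_pmf b))"
proof (rule pmf_eqI)
  fix i
  have "0 \<le> (1 - a) * b" "(1 - a) * b \<le> (1 - a) * 1"
    using assms by (simp_all only: mult_left_mono mult_nonneg_nonneg diff_ge_0_iff_ge)
  then have ab: "0 \<le> a + (1 - a) * b" "a + (1 - a) * b \<le> 1" using assms by auto
  have [simp]: "(\<or>) True = (\<lambda>x. True)" "(\<or>) False = (\<lambda>x. x)" by (auto simp: fun_eq_iff)
  show "pmf (bernoulli_pmf (a + (1 - a) * b)) i
      = pmf (bind_pmf (bernoulli_pmf a) (\<lambda>x. map_pmf ((\<or>) x) (bernoulli_pmf b))) i"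
    using assms ab by (cases i) (simp_all add: pmf_bind map_pmf_const algebra_simps)
qed

lemma distr_bfpp_reindex:
  assumes "inj f"
  shows "distr (bfpp p) (bfpp p) (\<lambda>\<omega> e. \<omega> (f e)) = bfpp p"
  using distr_PiM_reindex[of UNIV "\<lambda>_. measure_pmf (bernoulli_pmf p)" f UNIV] assms
  by (simp add: bfpp_def measure_pmf.prob_space_axioms restrict_def)

section \<open>Open paths in the lattice\<close>

definition edge_ends :: "('n::finite) edge \<Rightarrow> (int^'n) set" where
  "edge_ends e = {fst e, fst e + axis (snd e) 1}"

lemma axis_one_eq_iff: "axis i (1::int) = axis j 1 \<longleftrightarrow> i = (j::'n::finite)"
  by (simp add: axis_eq_axis)

lemma axis_add_axis_neq_zero: "axis i (1::int) + axis j 1 \<noteq> (0 :: int^'n::finite)"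
proof
  assume "axis i (1::int) + axis j 1 = (0 :: int^'n)"
  then have "(axis i (1::int) + axis j 1) $ i = (0 :: int^'n) $ i" by simp
  then show False by (simp add: axis_def split: if_splits)
qed

lemma lat_edge_axis [simp]:
  fixes u :: "int^'n::finite"
  shows "lat_edge u (u + axis i 1) = (u, i)" "lat_edge (u + axis i 1) u = (u, i)"
proof -
  have "(SOME j. u + axis i 1 = u + axis j (1::int)) = i"
    by (rule some_equality) (auto simp: axis_one_eq_iff)
  then show "lat_edge u (u + axis i 1) = (u, i)" by (auto simp: lat_edge_def)
  have "(\<nexists>j. u = u + axis i 1 + axis j (1::int))"
    using axis_add_axis_neq_zero[of i] by (auto simp: add.assoc)
  moreover have "(SOME j. u + axis i 1 = u + axis j (1::int)) = i"
    by (rule some_equality) (auto simp: axis_one_eq_iff)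
  ultimately show "lat_edge (u + axis i 1) u = (u, i)" by (auto simp: lat_edge_def)
qed

lemma lat_adjacent_cases:
  assumes "lat_adjacent u v"
  obtains i where "v = u + axis i 1" "lat_edge u v = (u, i)"
    | i where "u = v + axis i 1" "lat_edge u v = (v, i)"
  using assms unfolding lat_adjacent_def by force

lemma edge_ends_lat_edge: "lat_adjacent u v \<Longrightarrow> edge_ends (lat_edge u v) = {u, v}"
  by (erule lat_adjacent_cases) (auto simp: edge_ends_def)

lemma finite_lat_adjacent: "finite {v. lat_adjacent u (v :: int^'n::finite)}"
proof -
  have "{v. lat_adjacent u v} \<subseteq> range (\<lambda>i. u + axis i 1) \<union> range (\<lambda>i. u - axis i 1)"
    by (auto simp: lat_adjacent_def)
  then show ?thesis by (rule finite_subset) auto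
qed

definition incident :: "(int^'n::finite) set \<Rightarrow> 'n edge set" where
  "incident V = {e. edge_ends e \<inter> V \<noteq> {}}"

lemma finite_incident: "finite V \<Longrightarrow> finite (incident V)"
proof -
  assume "finite V"
  have "incident V \<subseteq> V \<times> UNIV \<union> (\<Union>i. (\<lambda>u. (u - axis i 1, i)) ` V)"
    by (force simp: incident_def edge_ends_def)
  then show ?thesis by (rule finite_subset) (use \<open>finite V\<close> in auto)
qed

definition inner_edges :: "(int^'n::finite) set \<Rightarrow> 'n edge set" where
  "inner_edges V = {e. edge_ends e \<subseteq> V}"

lemma inner_edges_subset_incident: "inner_edges V \<subseteq> incident V"
  by (auto simp: inner_edges_def incident_def edge_ends_def)

definition open_step :: "('n::finite) edge set \<Rightarrow> (int^'n) set \<Rightarrow> int^'n \<Rightarrow> int^'n \<Rightarrow> bool" where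
  "open_step A V u v \<longleftrightarrow> lat_adjacent u v \<and> lat_edge u v \<in> A \<and> u \<in> V \<and> v \<in> V"

abbreviation conn :: "('n::finite) edge set \<Rightarrow> (int^'n) set \<Rightarrow> int^'n \<Rightarrow> int^'n \<Rightarrow> bool" where
  "conn A V \<equiv> (open_step A V)\<^sup>*\<^sup>*"

lemma open_step_mono: "open_step A V u v \<Longrightarrow> A \<subseteq> B \<Longrightarrow> open_step B V u v"
  by (auto simp: open_step_def)

lemma conn_mono: "conn A V u v \<Longrightarrow> A \<subseteq> B \<Longrightarrow> conn B V u v"
  by (erule rtranclp_mono[THEN predicate2D, rotated]) (auto simp: open_step_def)

lemma conn_mono_vertices: "conn A V u v \<Longrightarrow> V \<subseteq> W \<Longrightarrow> conn A W u v"
  by (erule rtranclp_mono[THEN predicate2D, rotated]) (auto simp: open_step_def)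

lemma open_step_Int_inner: "open_step (A \<inter> inner_edges V) V = open_step A V"
  by (auto simp: fun_eq_iff open_step_def inner_edges_def edge_ends_lat_edge)

text \<open>A connection inside \<open>V\<close> reads only edges with both ends in
  \<open>V\<close>. This makes it a local event, and it makes it independent of the edges that leave
  \<open>V\<close>.\<close>

lemma conn_Int: "inner_edges V \<subseteq> E \<Longrightarrow> conn (A \<inter> E) V = conn A V"
  using open_step_Int_inner[of A V] open_step_Int_inner[of "A \<inter> E" V]
  by (simp add: Int_assoc Int_absorb1)

text \<open>Loop erasure: if the new first vertex already lies on the path, everything before it is
  dropped.\<close>

lemma rtranclp_imp_path:
  assumes "r\<^sup>*\<^sup>* x y"
  shows "\<exists>\<gamma>. \<gamma> \<noteq> [] \<and> hd \<gamma> = x \<and> last \<gamma> = y \<and> distinct \<gamma> \<and> successively r \<gamma>"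
  using assms
proof (induction rule: converse_rtranclp_induct)
  case base
  show ?case by (rule exI[of _ "[y]"]) auto
next
  case (step x z)
  then obtain \<gamma> where \<gamma>: "\<gamma> \<noteq> []" "hd \<gamma> = z" "last \<gamma> = y" "distinct \<gamma>" "successively r \<gamma>" by blast
  show ?case
  proof (cases "x \<in> set \<gamma>")
    case True
    then obtain a b where "\<gamma> = a @ x # b" by (auto simp: in_set_conv_decomp)
    with \<gamma> show ?thesis by (intro exI[of _ "x # b"]) (auto simp: successively_append_iff)
  next
    case False
    with \<gamma> step(1) show ?thesis by (intro exI[of _ "x # \<gamma>"]) (auto simp: successively_Cons)
  qed
qed

lemma successively_imp_rtranclp:
  "successively r \<gamma> \<Longrightarrow> \<gamma> \<noteq> [] \<Longrightarrow> r\<^sup>*\<^sup>* (hd \<gamma>) (last \<gamma>)"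
proof (induction \<gamma>)
  case (Cons x \<gamma>)
  then show ?case
    by (cases "\<gamma> = []") (auto simp: successively_Cons intro: converse_rtranclp_into_rtranclp)
qed simp

section \<open>Balls in graph distance and open self-avoiding paths with m edges\<close>

primrec lat_ball :: "int^'n::finite \<Rightarrow> nat \<Rightarrow> (int^'n) set" where
  "lat_ball x 0 = {x}"
| "lat_ball x (Suc n) = lat_ball x n \<union> (\<Union>u\<in>lat_ball x n. {v. lat_adjacent u v})"

lemma finite_lat_ball [simp]: "finite (lat_ball x n)"
  by (induction n) (auto simp: finite_lat_adjacent)

lemma lat_ball_mono: "m \<le> n \<Longrightarrow> lat_ball x m \<subseteq> lat_ball x n"
  by (rule lift_Suc_mono_le[of "lat_ball x"]) auto

lemma center_in_lat_ball [simp]: "x \<in> lat_ball x n"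
  using lat_ball_mono[of 0 n x] by auto

lemma nth_in_lat_ball:
  assumes "successively lat_adjacent \<gamma>" "i < length \<gamma>"
  shows "\<gamma> ! i \<in> lat_ball (hd \<gamma>) i"
  using assms(2)
proof (induction i)
  case 0
  then show ?case by (simp add: hd_conv_nth)
next
  case (Suc i)
  then show ?case using successively_nth[OF assms(1), of i] by auto
qed

definition long_open :: "('n::finite) edge set \<Rightarrow> nat \<Rightarrow> int^'n \<Rightarrow> bool" where
  "long_open A m x \<longleftrightarrow>
    (\<exists>\<gamma>. length \<gamma> = Suc m \<and> hd \<gamma> = x \<and> distinct \<gamma> \<and> successively (open_step A UNIV) \<gamma>)"

lemma long_open_mono: "long_open A m x \<Longrightarrow> A \<subseteq> B \<Longrightarrow> long_open B m x"
  unfolding long_open_def by (blast intro: successively_mono open_step_mono)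

lemma long_openI:
  assumes "hd \<gamma> = x" "distinct \<gamma>" "successively (open_step A UNIV) \<gamma>" "m < length \<gamma>"
  shows "long_open A m x"
proof -
  have "\<gamma> = take (Suc m) \<gamma> @ drop (Suc m) \<gamma>" by simp
  then have "successively (open_step A UNIV) (take (Suc m) \<gamma>)"
    using assms(3) by (metis successively_append_iff)
  moreover have "hd (take (Suc m) \<gamma>) = x" using assms by simp
  ultimately show ?thesis
    unfolding long_open_def using assms by (intro exI[of _ "take (Suc m) \<gamma>"]) auto
qed

lemma long_open_antimono: "long_open A n x \<Longrightarrow> m \<le> n \<Longrightarrow> long_open A m x"
  unfolding long_open_def[of A n] by (elim exE conjE) (rule long_openI, auto)

text \<open>A path with m edges stays in the ball of radius m, so the event is local.\<close>

lemma long_open_Int: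
  assumes "incident (lat_ball x m) \<subseteq> E"
  shows "long_open (A \<inter> E) m x \<longleftrightarrow> long_open A m x"
proof
  assume "long_open A m x"
  then obtain \<gamma> where \<gamma>: "length \<gamma> = Suc m" "hd \<gamma> = x" "distinct \<gamma>" "successively (open_step A UNIV) \<gamma>"
    unfolding long_open_def by blast
  have adj: "successively lat_adjacent \<gamma>"
    using \<gamma>(4) by (rule successively_mono) (auto simp: open_step_def)
  have "set \<gamma> \<subseteq> lat_ball x m"
    using nth_in_lat_ball[OF adj] lat_ball_mono[of _ m x] \<gamma>(1,2)
    by (fastforce simp: in_set_conv_nth less_Suc_eq_le)
  then have "successively (open_step (A \<inter> E) UNIV) \<gamma>"
    using assms
    by (intro successively_mono[OF \<gamma>(4)], unfold open_step_def incident_def)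
      (use edge_ends_lat_edge in blast)
  with \<gamma> show "long_open (A \<inter> E) m x" unfolding long_open_def by blast
qed (auto elim: long_open_mono)

definition boundary_pairs :: "(int^'n::finite) set \<Rightarrow> ((int^'n) \<times> (int^'n)) set" where
  "boundary_pairs S = {(u, v). u \<in> S \<and> v \<notin> S \<and> lat_adjacent u v}"

lemma finite_boundary_pairs: "finite S \<Longrightarrow> finite (boundary_pairs S)"
proof -
  assume "finite S"
  then have "finite (Sigma S (\<lambda>u. {v. lat_adjacent u v}))" by (auto simp: finite_lat_adjacent)
  then show ?thesis by (rule rev_finite_subset) (auto simp: boundary_pairs_def)
qed

text \<open>Self-avoidance limits the stretch before the first exit to \<open>card S\<close>
  vertices, so at least m + 1 of the m + \<open>card S\<close> + 1 vertices remain. \<open>B\<close>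
  and \<open>A - B\<close> are the disjoint witnesses that van den Berg--Kesten asks for.\<close>

lemma long_open_first_exit:
  assumes "long_open A (m + card S) x" "finite S" "x \<in> S"
  obtains u v B where "(u, v) \<in> boundary_pairs S" "B \<subseteq> A" "conn B S x u" "lat_edge u v \<in> B"
    "long_open (A - B) m v"
proof -
  from assms(1) obtain \<gamma> where \<gamma>: "length \<gamma> = Suc (m + card S)" "hd \<gamma> = x" "distinct \<gamma>"
      "successively (open_step A UNIV) \<gamma>"
    unfolding long_open_def by blast
  define a b where "a = takeWhile (\<lambda>y. y \<in> S) \<gamma>" and "b = dropWhile (\<lambda>y. y \<in> S) \<gamma>"
  have ab: "\<gamma> = a @ b" by (simp add: a_def b_def)
  have aS: "set a \<subseteq> S" unfolding a_def by (auto dest: set_takeWhileD)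
  have "distinct a" "distinct b" and disj: "set a \<inter> set b = {}" using \<gamma>(3) unfolding ab by auto
  then have "length a \<le> card S" using card_mono[OF assms(2) aS] by (simp add: distinct_card)
  then have lb: "m < length b" using \<gamma>(1) unfolding ab by simp
  then have "b \<noteq> []" by auto
  have "\<gamma> \<noteq> []" using \<gamma>(1) by auto
  then have "a \<noteq> []" using \<gamma>(2) assms(3) unfolding a_def by (cases \<gamma>) auto
  have succ: "successively (open_step A UNIV) a" "successively (open_step A UNIV) b"
    "open_step A UNIV (last a) (hd b)"
    using \<gamma>(4) \<open>a \<noteq> []\<close> \<open>b \<noteq> []\<close> unfolding ab successively_append_iff by auto
  \<comment> \<open>All open edges touching the stretch before the exit, not only those on it. They
    include the exit edge, and no edge of the rest, as the two stretches share no vertex.\<close>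
  define B where "B = A \<inter> incident (set a)"
  have la: "last a \<in> set a" using \<open>a \<noteq> []\<close> by simp
  have "hd b \<notin> S" using \<open>b \<noteq> []\<close> hd_dropWhile[of "\<lambda>y. y \<in> S" \<gamma>] unfolding b_def by auto
  then have bd: "(last a, hd b) \<in> boundary_pairs S"
    using succ(3) la aS by (auto simp: boundary_pairs_def open_step_def)
  have "successively (open_step B S) a"
    using aS by (intro successively_mono[OF succ(1)])
      (auto simp: open_step_def B_def incident_def edge_ends_lat_edge)
  from successively_imp_rtranclp[OF this \<open>a \<noteq> []\<close>] have "conn B S x (last a)"
    using \<gamma>(2) \<open>a \<noteq> []\<close> unfolding ab by simp
  moreover have "lat_edge (last a) (hd b) \<in> B"
    using succ(3) la by (auto simp: open_step_def B_def incident_def edge_ends_lat_edge)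
  moreover have "successively (open_step (A - B) UNIV) b"
    using disj by (intro successively_mono[OF succ(2)])
      (auto simp: open_step_def B_def incident_def edge_ends_lat_edge)
  then have "long_open (A - B) m (hd b)"
    using \<open>distinct b\<close> lb by (intro long_openI[of b]) auto
  moreover have "B \<subseteq> A" by (simp add: B_def)
  ultimately show thesis by (intro that[OF bd])
qed

section \<open>Translations of the lattice\<close>

definition shift_edge :: "int^'n::finite \<Rightarrow> 'n edge \<Rightarrow> 'n edge" where
  "shift_edge x e = (fst e + x, snd e)"

lemma inj_shift_edge: "inj (shift_edge x)"
  by (auto simp: inj_on_def shift_edge_def prod_eq_iff)

lemma lat_adjacent_shift [simp]: "lat_adjacent (u + x) (v + x) \<longleftrightarrow> lat_adjacent u v"
proof -
  have "v + x = u + x + w \<longleftrightarrow> v = u + w" "u + x = v + x + w \<longleftrightarrow> u = v + w" for w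
    by (auto simp: add_ac)
  then show ?thesis by (simp add: lat_adjacent_def)
qed

lemma lat_edge_shift: "lat_adjacent u v \<Longrightarrow> lat_edge (u + x) (v + x) = shift_edge x (lat_edge u v)"
proof (erule lat_adjacent_cases)
  fix i assume "v = u + axis i 1" "lat_edge u v = (u, i)"
  then show ?thesis using lat_edge_axis(1)[of "u + x" i] by (simp add: shift_edge_def add_ac)
next
  fix i assume "u = v + axis i 1" "lat_edge u v = (v, i)"
  then show ?thesis using lat_edge_axis(2)[of "v + x" i] by (simp add: shift_edge_def add_ac)
qed

lemma long_open_shift: "long_open {e. \<omega> (shift_edge x e)} m 0 \<longleftrightarrow> long_open {e. \<omega> e} m x"
proof
  let ?r = "open_step {e. \<omega> (shift_edge x e)} UNIV"
  let ?s = "open_step {e. \<omega> e} UNIV"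
  have rs: "?r u v \<longleftrightarrow> ?s (u + x) (v + x)" for u v
    by (auto simp: open_step_def lat_edge_shift)
  {
    assume "long_open {e. \<omega> (shift_edge x e)} m 0"
    then obtain \<gamma> where \<gamma>: "length \<gamma> = Suc m" "hd \<gamma> = 0" "distinct \<gamma>" "successively ?r \<gamma>"
      unfolding long_open_def by blast
    moreover have "\<gamma> \<noteq> []" using \<gamma>(1) by auto
    ultimately show "long_open {e. \<omega> e} m x"
      unfolding long_open_def rs
      by (intro exI[of _ "map (\<lambda>u. u + x) \<gamma>"])
        (auto simp: successively_map hd_map distinct_map inj_on_def)
  }
  {
    assume "long_open {e. \<omega> e} m x"
    then obtain \<gamma> where \<gamma>: "length \<gamma> = Suc m" "hd \<gamma> = x" "distinct \<gamma>" "successively ?s \<gamma>"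
      unfolding long_open_def by blast
    moreover have "\<gamma> \<noteq> []" using \<gamma>(1) by auto
    ultimately show "long_open {e. \<omega> (shift_edge x e)} m 0"
      unfolding long_open_def
      by (intro exI[of _ "map (\<lambda>u. u - x) \<gamma>"])
        (auto simp: successively_map hd_map distinct_map inj_on_def rs)
  }
qed

section \<open>Exponential decay below the critical probability\<close>

lemma measure_conn:
  assumes "finite E" "inner_edges S \<subseteq> E" "0 \<le> p" "p \<le> 1"
  shows "measure (bfpp p) {\<omega>. conn {e. \<omega> e} S x y} = config_exp p E (\<lambda>A. of_bool (conn A S x y))"
  using assms by (intro measure_bfpp_local_eq_config_exp[where Q = "\<lambda>A. conn A S x y"]) (simp_all add: conn_Int)

lemma measure_long_open:
  assumes "finite E" "incident (lat_ball x m) \<subseteq> E" "0 \<le> p" "p \<le> 1"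
  shows "measure (bfpp p) {\<omega>. long_open {e. \<omega> e} m x} = config_exp p E (\<lambda>A. of_bool (long_open A m x))"
  using assms by (intro measure_bfpp_local_eq_config_exp[where Q = "\<lambda>A. long_open A m x"]) (simp_all add: long_open_Int)

lemma sets_long_open: "{\<omega>. long_open {e. \<omega> e} m x} \<in> sets (bfpp p)"
proof -
  have "{\<omega>. long_open {e. \<omega> e} m x} = {\<omega>. long_open {e\<in>incident (lat_ball x m). \<omega> e} m x}"
    by (rule local_event_eq[where Q = "\<lambda>A. long_open A m x"]) (simp add: long_open_Int)
  also have "\<dots> \<in> sets (bfpp p)"
    by (rule sets_bfpp_finite[where Q = "\<lambda>A. long_open A m x"]) (simp add: finite_incident)
  finally show ?thesis .
qed

lemma measure_long_open_shift:
  fixes x :: "int^'n::finite"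
  shows "measure (bfpp p) {\<omega>. long_open {e. \<omega> e} m x}
    = measure (bfpp p) {\<omega>. long_open {e. \<omega> e} m (0 :: int^'n)}"
proof -
  let ?f = "\<lambda>\<omega> e. \<omega> (shift_edge x e)"
  have f: "?f \<in> measurable (bfpp p) (bfpp p)"
    by (intro measurable_into_bfpp measurable_bfpp_component)
  have "measure (bfpp p) {\<omega>. long_open {e. \<omega> e} m (0 :: int^'n)}
      = measure (distr (bfpp p) (bfpp p) ?f) {\<omega>. long_open {e. \<omega> e} m (0 :: int^'n)}"
    by (simp add: distr_bfpp_reindex[OF inj_shift_edge])
  also have "\<dots> = measure (bfpp p) (?f -` {\<omega>. long_open {e. \<omega> e} m (0 :: int^'n)} \<inter> space (bfpp p))"
    by (rule measure_distr[OF f sets_long_open])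
  also have "\<dots> = measure (bfpp p) {\<omega>. long_open {e. \<omega> e} m x}"
    by (simp add: vimage_def long_open_shift)
  finally show ?thesis ..
qed

text \<open>The \<phi> of the overview, without the factor p for the boundary edge itself. Pairs are
  oriented outwards, so every boundary edge is counted once, weighted by the probability that its
  inner end is reached inside \<open>S\<close>.\<close>

definition cut_exp :: "real \<Rightarrow> (int^'n::finite) set \<Rightarrow> real" where
  "cut_exp p S = (\<Sum>(u, v)\<in>boundary_pairs S. measure (bfpp p) {\<omega>. conn {e. \<omega> e} S 0 u})"

lemma boundary_edge_not_inner:
  "(u, v) \<in> boundary_pairs S \<Longrightarrow> lat_edge u v \<notin> inner_edges S"
  by (auto simp: boundary_pairs_def inner_edges_def edge_ends_lat_edge)

text \<open>A union bound over the exit edge produces the sum in \<open>cut_exp\<close>. The exit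
  edge is not an inner edge of \<open>S\<close>, so it contributes an independent factor p, and
  translation invariance moves the start of the remaining path back to the origin.\<close>

lemma long_open_decay_step:
  fixes S :: "(int^'n::finite) set"
  assumes p: "0 \<le> p" "p \<le> 1" and S: "finite S" "0 \<in> S"
  shows "measure (bfpp p) {\<omega>. long_open {e. \<omega> e} (m + card S) (0 :: int^'n)}
    \<le> p * cut_exp p S * measure (bfpp p) {\<omega>. long_open {e. \<omega> e} m (0 :: int^'n)}"
proof -
  \<comment> \<open>One finite edge set on which all events of the argument are local: the long path
    from 0, connections inside \<open>S\<close>, the exit edges, and the paths from their outer
    ends.\<close>
  define E where "E = incident (lat_ball 0 (m + card S)) \<union> incident S
    \<union> (\<Union>(u, v)\<in>boundary_pairs S. incident (lat_ball v m) \<union> {lat_edge u v})"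
  have finE: "finite E"
    unfolding E_def using S(1) by (auto simp: finite_incident finite_boundary_pairs)
  have inner: "inner_edges S \<subseteq> E"
    using inner_edges_subset_incident[of S] unfolding E_def by blast
  have "measure (bfpp p) {\<omega>. long_open {e. \<omega> e} (m + card S) (0 :: int^'n)}
      = config_exp p E (\<lambda>A. of_bool (long_open A (m + card S) (0 :: int^'n)))"
    by (rule measure_long_open[OF finE _ p]) (auto simp: E_def)
  also have "\<dots> \<le> config_exp p E (\<lambda>A. \<Sum>x\<in>boundary_pairs S.
      of_bool (\<exists>B\<subseteq>A. (conn B S 0 (fst x) \<and> lat_edge (fst x) (snd x) \<in> B) \<and> long_open (A - B) m (snd x)))"
    (is "_ \<le> config_exp p E (\<lambda>A. \<Sum>x\<in>_. of_bool (?Q A x))")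
  proof (rule config_exp_mono[OF p])
    fix A
    show "of_bool (long_open A (m + card S) (0 :: int^'n)) \<le> (\<Sum>x\<in>boundary_pairs S. of_bool (?Q A x) :: real)"
    proof (cases "long_open A (m + card S) (0 :: int^'n)")
      case True
      then obtain u v B where *: "(u, v) \<in> boundary_pairs S" "B \<subseteq> A" "conn B S 0 u" "lat_edge u v \<in> B"
        "long_open (A - B) m v" using long_open_first_exit[OF _ S] by metis
      then have "?Q A (u, v)" by auto
      then have "of_bool (long_open A (m + card S) (0 :: int^'n)) \<le> (of_bool (?Q A (u, v)) :: real)" by simp
      also have "\<dots> \<le> (\<Sum>x\<in>boundary_pairs S. of_bool (?Q A x))"
        using *(1) S(1) by (intro member_le_sum finite_boundary_pairs) auto
      finally show ?thesis .
    qed (auto intro: sum_nonneg)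
  qed
  also have "\<dots> = (\<Sum>x\<in>boundary_pairs S. config_exp p E (\<lambda>A. of_bool (?Q A x)))"
    by (rule config_exp_sum)
  also have "\<dots> \<le> (\<Sum>x\<in>boundary_pairs S. measure (bfpp p) {\<omega>. conn {e. \<omega> e} S 0 (fst x)} * p
      * measure (bfpp p) {\<omega>. long_open {e. \<omega> e} m (0 :: int^'n)})"
  proof (rule sum_mono)
    fix x assume x: "x \<in> boundary_pairs S"
    obtain u v where uv: "x = (u, v)" by (cases x)
    have e: "lat_edge u v \<in> E" using x uv unfolding E_def by auto
    have "config_exp p E (\<lambda>A. of_bool (?Q A x))
        \<le> config_exp p E (\<lambda>A. of_bool (conn A S 0 u \<and> lat_edge u v \<in> A))
          * config_exp p E (\<lambda>A. of_bool (long_open A m v))"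
      unfolding uv fst_conv snd_conv
      by (rule config_exp_disjoint_occurrence[OF finE p]) (auto intro: conn_mono long_open_mono)
    also have "config_exp p E (\<lambda>A. of_bool (long_open A m v))
        = measure (bfpp p) {\<omega>. long_open {e. \<omega> e} m v}"
      using x uv by (intro measure_long_open[OF finE _ p, symmetric]) (auto simp: E_def)
    also have "\<dots> = measure (bfpp p) {\<omega>. long_open {e. \<omega> e} m (0 :: int^'n)}"
      by (rule measure_long_open_shift)
    also have "config_exp p E (\<lambda>A. of_bool (conn A S 0 u \<and> lat_edge u v \<in> A))
        = config_exp p E (\<lambda>A. of_bool (conn A S 0 u)) * config_exp p E (\<lambda>A. of_bool (lat_edge u v \<in> A))"
      unfolding of_bool_conj
    proof (rule config_exp_indep[OF finE, where D = "- {lat_edge u v}"])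
      have "inner_edges S \<subseteq> - {lat_edge u v}" using boundary_edge_not_inner x uv by blast
      then show "of_bool (conn A S 0 u) = of_bool (conn (A \<inter> - {lat_edge u v}) S 0 u)" for A
        by (simp only: conn_Int)
    qed auto
    also have "config_exp p E (\<lambda>A. of_bool (conn A S 0 u)) = measure (bfpp p) {\<omega>. conn {e. \<omega> e} S 0 u}"
      by (rule measure_conn[OF finE inner p, symmetric])
    also have "config_exp p E (\<lambda>A. of_bool (lat_edge u v \<in> A)) = p"
      by (rule config_exp_member[OF finE e])
    finally show "config_exp p E (\<lambda>A. of_bool (?Q A x)) \<le> measure (bfpp p) {\<omega>. conn {e. \<omega> e} S 0 (fst x)} * p
      * measure (bfpp p) {\<omega>. long_open {e. \<omega> e} m (0 :: int^'n)}" by (simp add: uv)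
  qed
  also have "\<dots> = p * cut_exp p S * measure (bfpp p) {\<omega>. long_open {e. \<omega> e} m (0 :: int^'n)}"
    by (simp add: cut_exp_def case_prod_unfold sum_distrib_left sum_distrib_right mult_ac)
  finally show ?thesis .
qed

lemma long_open_exponential_decay:
  fixes S :: "(int^'n::finite) set"
  assumes p: "0 \<le> p" "p \<le> 1" and S: "finite S" "0 \<in> S" and cut: "p * cut_exp p S < 1"
  shows "\<exists>C \<rho>. 0 < \<rho> \<and> \<rho> < 1 \<and>
    (\<forall>m. measure (bfpp p) {\<omega>. long_open {e. \<omega> e} m (0 :: int^'n)} \<le> C * \<rho> ^ m)"
proof -
  define M where "M m = measure (bfpp p) {\<omega>. long_open {e. \<omega> e} m (0 :: int^'n)}" for m
  \<comment> \<open>The maximum with 1/2 keeps \<kappa> positive even if the product is 0, so that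
    its root is a valid rate.\<close>
  define \<kappa> where "\<kappa> = max (1/2) (p * cut_exp p S)"
  have \<kappa>: "0 < \<kappa>" "\<kappa> < 1" "p * cut_exp p S \<le> \<kappa>" using cut by (auto simp: \<kappa>_def)
  define s where "s = card S"
  have s: "0 < s" using S by (auto simp: s_def card_gt_0_iff)
  define \<rho> where "\<rho> = root s \<kappa>"
  have \<rho>: "0 < \<rho>" "\<rho> < 1" "\<rho> ^ s = \<kappa>"
    using \<kappa> s by (auto simp: \<rho>_def real_root_lt_1_iff)
  have M_anti: "M n \<le> M m" if "m \<le> n" for m n
    unfolding M_def using that by (intro bfpp.finite_measure_mono sets_long_open) (auto intro: long_open_antimono)
  have M_step: "M (m + s) \<le> \<kappa> * M m" for m
  proof -
    have "M (m + s) \<le> p * cut_exp p S * M m"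
      unfolding M_def s_def by (rule long_open_decay_step[OF p S])
    also have "\<dots> \<le> \<kappa> * M m" using \<kappa>(3) by (intro mult_right_mono) (auto simp: M_def)
    finally show ?thesis .
  qed
  have M_iter: "M (k * s) \<le> \<kappa> ^ k" for k
  proof (induction k)
    case 0
    then show ?case by (simp add: M_def)
  next
    case (Suc k)
    have "M (Suc k * s) \<le> \<kappa> * M (k * s)" using M_step[of "k * s"] by (simp add: add_ac)
    also have "\<dots> \<le> \<kappa> * \<kappa> ^ k" using Suc \<kappa>(1) by (intro mult_left_mono) auto
    finally show ?case by simp
  qed
  \<comment> \<open>The prefactor pays for the incomplete last block of fewer than s edges.\<close>
  have "M m \<le> 1 / \<rho> ^ s * \<rho> ^ m" for m
  proof -
    have "M m \<le> M (m div s * s)" by (rule M_anti) simp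
    also have "\<dots> \<le> \<rho> ^ (s * (m div s))" using M_iter \<rho>(3) by (simp add: power_mult)
    finally have "\<rho> ^ s * M m \<le> \<rho> ^ s * \<rho> ^ (s * (m div s))" using \<rho> by (intro mult_left_mono) auto
    also have "\<dots> = \<rho> ^ (s + s * (m div s))" by (simp add: power_add)
    also have "\<dots> \<le> \<rho> ^ m"
    proof (rule power_decreasing)
      show "m \<le> s + s * (m div s)" using s dividend_less_times_div[of s m] by (simp add: mult.commute)
    qed (use \<rho> in auto)
    finally show ?thesis using \<rho>(1) by (simp add: pos_le_divide_eq mult.commute)
  qed
  then show ?thesis using \<rho> unfolding M_def by blast
qed

section \<open>The trapped set and the differential inequality\<close>

definition escapes :: "(int^'n::finite) set \<Rightarrow> 'n edge set \<Rightarrow> int^'n \<Rightarrow> bool" where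
  "escapes B A x \<longleftrightarrow> (\<exists>v. v \<notin> B \<and> conn A UNIV x v)"

definition trapped :: "(int^'n::finite) set \<Rightarrow> 'n edge set \<Rightarrow> (int^'n) set" where
  "trapped B A = {x\<in>B. \<not> escapes B A x}"

lemma escapes_mono: "escapes B A x \<Longrightarrow> A \<subseteq> A' \<Longrightarrow> escapes B A' x"
  unfolding escapes_def by (elim exE conjE, intro exI conjI, assumption, erule conn_mono)

lemma escapes_step: "escapes B A y \<Longrightarrow> open_step A UNIV x y \<Longrightarrow> escapes B A x"
  unfolding escapes_def
  by (elim exE conjE, intro exI conjI, assumption, erule (1) converse_rtranclp_into_rtranclp)

lemma open_step_remove_inner:
  "open_step (A - inner_edges T) UNIV u v \<longleftrightarrow> open_step A UNIV u v \<and> \<not> (u \<in> T \<and> v \<in> T)"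
  by (auto simp: open_step_def inner_edges_def edge_ends_lat_edge)

text \<open>The trapped set is explored from outside, so the event that it equals \<open>T\<close>
  does not reveal the edges inside \<open>T\<close>.\<close>

lemma trapped_remove_inner:
  assumes "T \<subseteq> B"
  shows "trapped B (A - inner_edges T) = T \<longleftrightarrow> trapped B A = T"
proof
  assume tr: "trapped B A = T"
  have "T \<subseteq> trapped B (A - inner_edges T)"
    using tr escapes_mono[of B "A - inner_edges T" _ A] by (auto simp: trapped_def)
  \<comment> \<open>Every vertex of an open path to the outside escapes itself, so such a path
    avoids \<open>T\<close> and survives the removal.\<close>
  moreover have "x \<notin> trapped B (A - inner_edges T)" if "x \<in> B" "x \<notin> T" for x
  proof -
    have "escapes B A x" using that tr by (auto simp: trapped_def)
    then obtain v where v: "v \<notin> B" "conn A UNIV x v" by (auto simp: escapes_def)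
    have "conn (A - inner_edges T) UNIV x v" using v(2) that(2)
    proof (induction rule: converse_rtranclp_induct)
      case (step x z)
      have "escapes B A z" using step.hyps(2) v(1) by (auto simp: escapes_def)
      then have "z \<notin> T" using tr by (auto simp: trapped_def)
      then have "open_step (A - inner_edges T) UNIV x z"
        using step.hyps(1) by (simp only: open_step_remove_inner simp_thms)
      moreover have "conn (A - inner_edges T) UNIV z v" by (rule step.IH[OF \<open>z \<notin> T\<close>])
      ultimately show ?case by (rule converse_rtranclp_into_rtranclp)
    qed simp
    then show ?thesis using v(1) by (auto simp: trapped_def escapes_def)
  qed
  ultimately show "trapped B (A - inner_edges T) = T" by (auto simp: trapped_def)
next
  assume tr: "trapped B (A - inner_edges T) = T"
  have "trapped B A \<subseteq> T"
    using tr escapes_mono[of B "A - inner_edges T" _ A] by (auto simp: trapped_def)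
  \<comment> \<open>Followed backwards from its end outside \<open>B\<close>, a path meeting
    \<open>T\<close> would enter it from a vertex that still escapes, through an edge not inside
    \<open>T\<close>. That edge was kept, so the entered vertex would escape as well.\<close>
  moreover have "x \<notin> T" if "conn A UNIV x v" "v \<notin> B" for x v
    using that(1)
  proof (induction rule: converse_rtranclp_induct)
    case base
    then show ?case using that(2) assms by auto
  next
    case (step x z)
    show "x \<notin> T"
    proof
      assume "x \<in> T"
      with step have "open_step (A - inner_edges T) UNIV x z" by (auto simp: open_step_remove_inner)
      moreover have "escapes B (A - inner_edges T) z"
      proof (cases "z \<in> B")
        case True
        then show ?thesis using step.IH tr by (auto simp: trapped_def)
      next
        case False
        then show ?thesis by (auto simp: escapes_def)
      qed
      ultimately have "escapes B (A - inner_edges T) x" by (rule escapes_step[rotated])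
      then show False using \<open>x \<in> T\<close> tr by (auto simp: trapped_def)
    qed
  qed
  then have "T \<subseteq> trapped B A" using assms by (auto simp: trapped_def escapes_def)
  ultimately show "trapped B A = T" by auto
qed

text \<open>Every vertex outside \<open>T\<close> escapes, whether or not it lies in
  \<open>B\<close>. Hence an edge leaving \<open>T\<close> must be closed, and opening it joins 0
  through \<open>u\<close> to the outside.\<close>

lemma boundary_edge_pivotal:
  assumes T: "trapped B A = T" "0 \<in> T" and uv: "(u, v) \<in> boundary_pairs T" and conn: "conn A T 0 u"
  shows "lat_edge u v \<notin> A" "\<not> escapes B A 0" "escapes B (insert (lat_edge u v) A) 0"
    "lat_edge u v \<in> incident B"
proof -
  let ?e = "lat_edge u v"
  have u: "u \<in> T" "v \<notin> T" "lat_adjacent u v" using uv by (auto simp: boundary_pairs_def)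
  have "u \<in> B" using u(1) T(1) by (auto simp: trapped_def)
  then show "?e \<in> incident B" using u(3) by (simp add: incident_def edge_ends_lat_edge)
  have v: "escapes B A v"
    using u(2) T(1) by (cases "v \<in> B") (auto simp: trapped_def escapes_def)
  show "\<not> escapes B A 0" using T by (auto simp: trapped_def)
  show "?e \<notin> A"
  proof
    assume "?e \<in> A"
    then have "open_step A UNIV u v" using u(3) by (simp add: open_step_def)
    with v have "escapes B A u" by (rule escapes_step)
    then show False using u(1) T(1) by (auto simp: trapped_def)
  qed
  have "open_step (insert ?e A) UNIV u v" using u(3) by (simp add: open_step_def)
  with escapes_mono[OF v subset_insertI] have eu: "escapes B (insert ?e A) u"
    by (rule escapes_step)
  have "conn (insert ?e A) UNIV 0 u"
    by (rule conn_mono_vertices[OF conn_mono[OF conn]]) auto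
  with eu show "escapes B (insert ?e A) 0"
    unfolding escapes_def by (meson rtranclp_trans)
qed

text \<open>Only one of the two orientations of an edge leads out of \<open>T\<close>, so counting
  pairs is counting edges.\<close>

lemma inj_on_boundary_edge: "inj_on (\<lambda>(u, v). lat_edge u v) (boundary_pairs T)"
proof (rule inj_onI, clarify)
  fix u v u' v'
  assume uv: "(u, v) \<in> boundary_pairs T" "(u', v') \<in> boundary_pairs T" "lat_edge u v = lat_edge u' v'"
  then have "{u, v} = {u', v'}"
    using edge_ends_lat_edge[of u v] edge_ends_lat_edge[of u' v'] by (simp add: boundary_pairs_def)
  then show "u = u' \<and> v = v'" using uv(1,2) by (auto simp: boundary_pairs_def doubleton_eq_iff)
qed

text \<open>Split according to the trapped set T when 0 is trapped. That event ignores the edges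
  inside T, so given it the expected number of boundary edges reached inside T is
  \<open>cut_exp p T\<close>, which is at least 1/p, and all these edges are closed and pivotal. The
  double negation is the shape in which \<open>config_exp_decreasing_derivative\<close> delivers the
  count for the event of being trapped.\<close>

lemma expected_pivotals_ge:
  fixes B :: "(int^'n::finite) set"
  assumes p: "0 < p" "p < 1" and B: "finite B" "0 \<in> B"
    and cut: "\<And>S :: (int^'n) set. finite S \<Longrightarrow> 0 \<in> S \<Longrightarrow> 1 \<le> p * cut_exp p S"
  defines "E \<equiv> incident B"
  shows "config_exp p E (\<lambda>A. of_bool (\<not> escapes B A 0)) \<le> p * config_exp p E (\<lambda>A.
    real (card {e\<in>E. e \<notin> A \<and> \<not> escapes B A 0 \<and> \<not> \<not> escapes B (insert e A) 0}))"
proof -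
  have finE: "finite E" unfolding E_def by (rule finite_incident[OF B(1)])
  have p': "0 \<le> p" "p \<le> 1" using p by auto
  let ?TT = "{T\<in>Pow B. 0 \<in> T}"
  have finTT: "finite ?TT" using B(1) by auto
  let ?piv = "\<lambda>A. {e\<in>E. e \<notin> A \<and> \<not> escapes B A 0 \<and> \<not> \<not> escapes B (insert e A) 0}"
  have tr: "of_bool (\<not> escapes B A 0) = (\<Sum>T\<in>?TT. of_bool (trapped B A = T) :: real)" for A
  proof (cases "escapes B A 0")
    case True
    then have "trapped B A \<noteq> T" if "0 \<in> T" for T using that by (auto simp: trapped_def)
    then show ?thesis using True by (auto intro!: sum.neutral[symmetric])
  next
    case False
    then have "trapped B A \<in> ?TT" using B(2) by (auto simp: trapped_def)
    then show ?thesis using False finTT by (simp add: of_bool_def sum.delta')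
  qed
  have "config_exp p E (\<lambda>A. of_bool (\<not> escapes B A 0))
      = (\<Sum>T\<in>?TT. config_exp p E (\<lambda>A. of_bool (trapped B A = T)))"
    by (simp only: tr config_exp_sum)
  also have "\<dots> \<le> (\<Sum>T\<in>?TT. config_exp p E (\<lambda>A. of_bool (trapped B A = T)) * (p * cut_exp p T))"
  proof (rule sum_mono)
    fix T assume T: "T \<in> ?TT"
    then have "finite T" using B(1) finite_subset by auto
    then have "1 \<le> p * cut_exp p T" using T cut by auto
    moreover have "0 \<le> config_exp p E (\<lambda>A. of_bool (trapped B A = T))"
      by (rule config_exp_nonneg[OF p']) simp
    ultimately show "config_exp p E (\<lambda>A. of_bool (trapped B A = T))
      \<le> config_exp p E (\<lambda>A. of_bool (trapped B A = T)) * (p * cut_exp p T)"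
      using mult_left_mono by fastforce
  qed
  also have "\<dots> = p * (\<Sum>T\<in>?TT. config_exp p E (\<lambda>A. of_bool (trapped B A = T)) * cut_exp p T)"
    by (simp add: sum_distrib_left mult_ac)
  also have "(\<Sum>T\<in>?TT. config_exp p E (\<lambda>A. of_bool (trapped B A = T)) * cut_exp p T)
    = (\<Sum>T\<in>?TT. \<Sum>x\<in>boundary_pairs T. config_exp p E (\<lambda>A. of_bool (conn A T 0 (fst x)) * of_bool (trapped B A = T)))"
    unfolding cut_exp_def sum_distrib_left case_prod_unfold
  proof (intro sum.cong refl)
    fix T x assume T: "T \<in> ?TT"
    have inner: "inner_edges T \<subseteq> E"
      using T unfolding E_def inner_edges_def incident_def edge_ends_def by auto
    have "config_exp p E (\<lambda>A. of_bool (conn A T 0 (fst x)) * of_bool (trapped B A = T))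
      = config_exp p E (\<lambda>A. of_bool (conn A T 0 (fst x))) * config_exp p E (\<lambda>A. of_bool (trapped B A = T))"
      using T by (intro config_exp_indep[OF finE, where D = "inner_edges T"])
        (simp_all add: conn_Int trapped_remove_inner)
    then show "config_exp p E (\<lambda>A. of_bool (trapped B A = T)) * measure (bfpp p) {\<omega>. conn {e. \<omega> e} T 0 (fst x)}
      = config_exp p E (\<lambda>A. of_bool (conn A T 0 (fst x)) * of_bool (trapped B A = T))"
      by (simp add: measure_conn[OF finE inner p'])
  qed
  also have "\<dots> = config_exp p E (\<lambda>A. \<Sum>T\<in>?TT. \<Sum>x\<in>boundary_pairs T.
      of_bool (conn A T 0 (fst x)) * of_bool (trapped B A = T))"
    by (simp only: config_exp_sum)
  also have "\<dots> \<le> config_exp p E (\<lambda>A. real (card (?piv A)))"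
  proof (rule config_exp_mono[OF p'])
    fix A
    let ?T = "trapped B A"
    show "(\<Sum>T\<in>?TT. \<Sum>x\<in>boundary_pairs T. of_bool (conn A T 0 (fst x)) * of_bool (?T = T)) \<le> real (card (?piv A))"
    proof (cases "0 \<in> ?T")
      case False
      then show ?thesis by (intro order_trans[OF sum_nonpos]) (auto intro!: sum_nonpos)
    next
      case True
      have fT: "finite ?T" using B(1) by (auto simp: trapped_def)
      have "(\<Sum>T\<in>?TT. \<Sum>x\<in>boundary_pairs T. of_bool (conn A T 0 (fst x)) * of_bool (?T = T))
        = (\<Sum>T\<in>?TT. if ?T = T then (\<Sum>x\<in>boundary_pairs T. of_bool (conn A T 0 (fst x))) else 0 :: real)"
        by (intro sum.cong refl) auto
      also have "\<dots> = (\<Sum>x\<in>boundary_pairs ?T. of_bool (conn A ?T 0 (fst x)))"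
        using True finTT by (subst sum.delta') (auto simp: trapped_def)
      also have "\<dots> = real (card {x\<in>boundary_pairs ?T. conn A ?T 0 (fst x)})"
        using finite_boundary_pairs[OF fT] by (simp add: of_bool_def sum.If_cases Int_def conj_commute)
      also have "card {x\<in>boundary_pairs ?T. conn A ?T 0 (fst x)} \<le> card (?piv A)"
      proof (rule card_inj_on_le[where f = "\<lambda>(u, v). lat_edge u v"])
        show "inj_on (\<lambda>(u, v). lat_edge u v) {x\<in>boundary_pairs ?T. conn A ?T 0 (fst x)}"
          by (rule inj_on_subset[OF inj_on_boundary_edge]) auto
        show "(\<lambda>(u, v). lat_edge u v) ` {x\<in>boundary_pairs ?T. conn A ?T 0 (fst x)} \<subseteq> ?piv A"
          using boundary_edge_pivotal[OF refl True] unfolding E_def by fastforce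
      qed (use finE in auto)
      finally show ?thesis by simp
    qed
  qed
  finally show ?thesis using p by simp
qed

text \<open>A path with at most m edges cannot leave the ball of radius m.\<close>

lemma escapes_lat_ball_imp_long_open:
  assumes "escapes (lat_ball x m) A x"
  shows "long_open A m x"
proof -
  from assms obtain v where v: "v \<notin> lat_ball x m" "conn A UNIV x v" by (auto simp: escapes_def)
  from rtranclp_imp_path[OF v(2)] obtain \<gamma> where \<gamma>: "\<gamma> \<noteq> []" "hd \<gamma> = x" "last \<gamma> = v" "distinct \<gamma>"
    "successively (open_step A UNIV) \<gamma>" by blast
  have adj: "successively lat_adjacent \<gamma>"
    using \<gamma>(5) by (rule successively_mono) (auto simp: open_step_def)
  have "v \<in> lat_ball x (length \<gamma> - 1)"
    using nth_in_lat_ball[OF adj, of "length \<gamma> - 1"] \<gamma> by (simp add: last_conv_nth)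
  then have "\<not> length \<gamma> - 1 \<le> m" using lat_ball_mono[of "length \<gamma> - 1" m x] v(1) by auto
  then show ?thesis using \<gamma> by (intro long_openI[of \<gamma>]) auto
qed

text \<open>Let g(p) be the probability that 0 is trapped. Russo's formula and
  \<open>expected_pivotals_ge\<close> give g' \<le> - g / (p (1 - p)), for which p / (1 - p) is the
  integrating factor: its product with g does not increase. The bound obtained is the same for all
  \<open>B\<close>.\<close>

lemma trapped_prob_le:
  fixes B :: "(int^'n::finite) set"
  assumes ab: "0 < a" "a < b" "b < 1" and B: "finite B" "0 \<in> B"
    and cut: "\<And>p S. a \<le> p \<Longrightarrow> p \<le> b \<Longrightarrow> finite S \<Longrightarrow> (0 :: int^'n) \<in> S \<Longrightarrow> 1 \<le> p * cut_exp p S"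
  shows "config_exp b (incident B) (\<lambda>A. of_bool (\<not> escapes B A 0)) \<le> a / (1 - a) * ((1 - b) / b)"
proof -
  let ?E = "incident B"
  define g where "g p = config_exp p ?E (\<lambda>A. of_bool (\<not> escapes B A 0))" for p
  have finE: "finite ?E" by (rule finite_incident[OF B(1)])
  have "g b * (b / (1 - b)) \<le> g a * (a / (1 - a))"
  proof (rule DERIV_nonpos_imp_nonincreasing[where f = "\<lambda>p. g p * (p / (1 - p))"])
    show "a \<le> b" using ab by simp
    fix p assume p: "a \<le> p" "p \<le> b"
    then have p': "0 < p" "p < 1" using ab by auto
    obtain d where d: "(g has_real_derivative d) (at p)"
      unfolding g_def using config_exp_has_derivative[OF finE] by blast
    define piv where "piv = config_exp p ?E
      (\<lambda>A. real (card {e\<in>?E. e \<notin> A \<and> \<not> escapes B A 0 \<and> \<not> \<not> escapes B (insert e A) 0}))"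
    have "(1 - p) * d = - piv"
      unfolding piv_def
      by (rule config_exp_decreasing_derivative[OF finE _ d[unfolded g_def]])
        (blast dest: escapes_mono)
    moreover have "g p \<le> p * piv"
      unfolding g_def piv_def using cut p by (intro expected_pivotals_ge[OF p' B]) auto
    ultimately have le: "g p + p * ((1 - p) * d) \<le> 0" by simp
    have "((\<lambda>p. g p * (p / (1 - p))) has_real_derivative
        ((g p + p * ((1 - p) * d)) / (1 - p)\<^sup>2)) (at p)"
      using p' by (auto intro!: derivative_eq_intros d simp: field_simps power2_eq_square)
    moreover have "(g p + p * ((1 - p) * d)) / (1 - p)\<^sup>2 \<le> 0"
      using le by (rule divide_nonpos_nonneg) simp
    ultimately show "\<exists>y. ((\<lambda>p. g p * (p / (1 - p))) has_real_derivative y) (at p) \<and> y \<le> 0" by blast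
  qed
  also have "g a \<le> 1"
    unfolding g_def using ab config_exp_mono[of a ?E "\<lambda>A. of_bool (\<not> escapes B A 0)" "\<lambda>_. 1"]
    by (simp add: config_exp_const[OF finE])
  then have "g a * (a / (1 - a)) \<le> 1 * (a / (1 - a))" using ab by (intro mult_right_mono) auto
  finally have "g b * (b / (1 - b)) * ((1 - b) / b) \<le> 1 * (a / (1 - a)) * ((1 - b) / b)"
    using ab by (intro mult_right_mono) auto
  moreover have "g b * (b / (1 - b)) * ((1 - b) / b) = g b" using ab by simp
  ultimately show ?thesis unfolding g_def by simp
qed

section \<open>From a uniform lower bound on long paths to percolation\<close>

lemma long_open_prob_ge:
  assumes ab: "0 < a" "a < b" "b < 1"
    and cut: "\<And>p S. a \<le> p \<Longrightarrow> p \<le> b \<Longrightarrow> finite S \<Longrightarrow> (0 :: int^'n::finite) \<in> S \<Longrightarrow> 1 \<le> p * cut_exp p S"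
  shows "1 - a / (1 - a) * ((1 - b) / b) \<le> measure (bfpp b) {\<omega>. long_open {e. \<omega> e} m (0 :: int^'n)}"
proof -
  let ?B = "lat_ball (0 :: int^'n) m"
  have E: "finite (incident ?B)" by (simp add: finite_incident)
  have "1 - a / (1 - a) * ((1 - b) / b) \<le> 1 - config_exp b (incident ?B) (\<lambda>A. of_bool (\<not> escapes ?B A 0))"
    using trapped_prob_le[OF ab _ _ cut, of ?B] by simp
  also have "\<dots> = config_exp b (incident ?B) (\<lambda>A. 1 - of_bool (\<not> escapes ?B A 0))"
    by (simp add: config_exp_diff config_exp_const[OF E])
  also have "\<dots> \<le> config_exp b (incident ?B) (\<lambda>A. of_bool (long_open A m 0))"
    using ab by (intro config_exp_mono) (auto dest: escapes_lat_ball_imp_long_open)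
  also have "\<dots> = measure (bfpp b) {\<omega>. long_open {e. \<omega> e} m (0 :: int^'n)}"
    using ab by (intro measure_long_open[OF E, symmetric]) auto
  finally show ?thesis .
qed

text \<open>Koenig's lemma: extend a path that has arbitrarily long extensions.\<close>

lemma infinite_open_path:
  assumes "\<And>m. long_open A m x"
  shows "\<exists>f :: nat \<Rightarrow> int^'n::finite. inj f \<and> (\<forall>k. open_step A UNIV (f k) (f (Suc k)))"
proof -
  define ext where "ext \<gamma> \<longleftrightarrow> \<gamma> \<noteq> [] \<and> (\<forall>m. \<exists>\<delta>. length \<delta> = m \<and> distinct (\<gamma> @ \<delta>)
    \<and> successively (open_step A UNIV) (\<gamma> @ \<delta>))" for \<gamma>
  have step: "\<exists>y. ext (\<gamma> @ [y])" if "ext \<gamma>" for \<gamma>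
  proof (rule ccontr)
    assume "\<nexists>y. ext (\<gamma> @ [y])"
    then have "\<forall>y. \<exists>m. \<not> (\<exists>\<delta>. length \<delta> = m \<and> distinct ((\<gamma> @ [y]) @ \<delta>)
      \<and> successively (open_step A UNIV) ((\<gamma> @ [y]) @ \<delta>))" by (auto simp: ext_def)
    then obtain m where m: "\<And>y. \<not> (\<exists>\<delta>. length \<delta> = m y \<and> distinct ((\<gamma> @ [y]) @ \<delta>)
      \<and> successively (open_step A UNIV) ((\<gamma> @ [y]) @ \<delta>))" by metis
    let ?N = "{y. lat_adjacent (last \<gamma>) y}"
    \<comment> \<open>Each candidate y fails at some length \<open>m y\<close>. An extension of
      length M + 1 starts with one of the finitely many neighbours y and contains \<open>m y\<close>
      further vertices beyond it, a contradiction.\<close>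
    define M where "M = Max (m ` ?N)"
    from that obtain \<delta> where \<delta>: "length \<delta> = Suc M" "distinct (\<gamma> @ \<delta>)"
      "successively (open_step A UNIV) (\<gamma> @ \<delta>)" and "\<gamma> \<noteq> []" unfolding ext_def by blast
    then obtain y \<epsilon> where y: "\<delta> = y # \<epsilon>" by (cases \<delta>) auto
    have "lat_adjacent (last \<gamma>) y"
      using \<delta>(3) \<open>\<gamma> \<noteq> []\<close> unfolding y successively_append_iff by (auto simp: open_step_def)
    then have "m y \<le> M" unfolding M_def by (intro Max_ge finite_imageI finite_lat_adjacent) auto
    then have len: "length (take (m y) \<epsilon>) = m y" using \<delta>(1) y by simp
    have eq: "\<gamma> @ \<delta> = ((\<gamma> @ [y]) @ take (m y) \<epsilon>) @ drop (m y) \<epsilon>" by (simp add: y)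
    have "distinct ((\<gamma> @ [y]) @ take (m y) \<epsilon>)" using \<delta>(2) unfolding eq distinct_append by blast
    moreover have "successively (open_step A UNIV) ((\<gamma> @ [y]) @ take (m y) \<epsilon>)"
      using \<delta>(3) unfolding eq successively_append_iff[of _ _ "drop (m y) \<epsilon>"] by blast
    ultimately show False using m[of y] len by blast
  qed
  have "ext [x]"
    unfolding ext_def
  proof (intro conjI allI)
    fix m
    from assms[of m] obtain \<gamma> where \<gamma>: "length \<gamma> = Suc m" "hd \<gamma> = x" "distinct \<gamma>"
      "successively (open_step A UNIV) \<gamma>" unfolding long_open_def by blast
    then show "\<exists>\<delta>. length \<delta> = m \<and> distinct ([x] @ \<delta>) \<and> successively (open_step A UNIV) ([x] @ \<delta>)"
      by (cases \<gamma>) auto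
  qed simp
  have "\<exists>g. \<forall>n. (ext (g n) \<and> length (g n) = Suc n) \<and> (\<exists>y. g (Suc n) = g n @ [y])"
  proof (rule dependent_nat_choice)
    show "\<exists>\<gamma>. ext \<gamma> \<and> length \<gamma> = Suc 0" using \<open>ext [x]\<close> by (intro exI[of _ "[x]"]) simp
    fix \<gamma> n assume "ext \<gamma> \<and> length \<gamma> = Suc n"
    then show "\<exists>\<gamma>'. (ext \<gamma>' \<and> length \<gamma>' = Suc (Suc n)) \<and> (\<exists>y. \<gamma>' = \<gamma> @ [y])"
      using step[of \<gamma>] by auto
  qed
  then obtain g where g: "\<And>n. ext (g n)" "\<And>n. length (g n) = Suc n" "\<And>n. \<exists>y. g (Suc n) = g n @ [y]"
    by blast
  define f where "f n = last (g n)" for n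
  have g_Suc: "g (Suc n) = g n @ [f (Suc n)]" for n using g(3)[of n] by (auto simp: f_def)
  have g_eq: "g n = map f [0..<Suc n]" for n
  proof (induction n)
    case 0
    have "length (g 0) = Suc 0" by (rule g(2))
    then show ?case by (auto simp: f_def length_Suc_conv)
  next
    case (Suc n)
    then show ?case by (simp add: g_Suc)
  qed
  have "distinct (g n)" "successively (open_step A UNIV) (g n)" for n
    using g(1)[of n] unfolding ext_def by (auto simp: successively_append_iff)
  note gn = this
  have "inj f"
  proof (rule linorder_injI)
    fix i j :: nat assume "i < j"
    with gn(1)[of j] show "f i \<noteq> f j"
      unfolding g_eq distinct_map by (auto simp: inj_on_def)
  qed
  moreover have "open_step A UNIV (f k) (f (Suc k))" for k
    using gn(2)[of "Suc k"] unfolding g_eq by (simp add: successively_append_iff)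
  ultimately show ?thesis by blast
qed

text \<open>Koenig's lemma expresses the infinite path by local events. This makes percolation
  measurable and lets a bound uniform in m pass to the limit.\<close>

lemma perc_event_eq:
  "(perc_event :: (('n::finite) edge \<Rightarrow> bool) set) = {\<omega>. \<exists>x. \<forall>m. long_open {e. \<omega> e} m x}"
proof (intro set_eqI iffI)
  fix \<omega> :: "'n edge \<Rightarrow> bool" assume "\<omega> \<in> perc_event"
  then obtain f :: "nat \<Rightarrow> int^'n" where f: "inj f"
    "\<And>k. open_step {e. \<omega> e} UNIV (f k) (f (Suc k))" by (auto simp: perc_event_def open_step_def)
  have "long_open {e. \<omega> e} m (f 0)" for m
    unfolding long_open_def
  proof (intro exI conjI)
    show "distinct (map f [0..<Suc m])" using f(1) by (auto simp: distinct_map inj_on_def simp del: upt_Suc)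
    show "successively (open_step {e. \<omega> e} UNIV) (map f [0..<Suc m])"
      unfolding successively_conv_nth using f(2) by (auto simp: nth_append simp del: upt_Suc)
    show "hd (map f [0..<Suc m]) = f 0" by (simp add: hd_map hd_append del: upt_Suc)
  qed simp
  then show "\<omega> \<in> {\<omega>. \<exists>x. \<forall>m. long_open {e. \<omega> e} m x}" by blast
next
  fix \<omega> :: "'n edge \<Rightarrow> bool" assume "\<omega> \<in> {\<omega>. \<exists>x. \<forall>m. long_open {e. \<omega> e} m x}"
  then show "\<omega> \<in> perc_event"
    using infinite_open_path[of "{e. \<omega> e}"] unfolding perc_event_def open_step_def by fastforce
qed

lemma sets_perc_event: "perc_event \<in> sets (bfpp p)"
proof -
  have "perc_event = (\<Union>x. \<Inter>m. {\<omega>. long_open {e. \<omega> e} m x})" by (auto simp: perc_event_eq)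
  also have "\<dots> \<in> sets (bfpp p)"
    using sets.top[of "bfpp p"] by (intro sets.countable_UN'' sets.countable_INT'' sets_long_open) auto
  finally show ?thesis .
qed

lemma measure_perc_event_ge:
  assumes "\<And>m. \<delta> \<le> measure (bfpp p) {\<omega>. long_open {e. \<omega> e} m (0 :: int^'n::finite)}"
  shows "\<delta> \<le> measure (bfpp p) (perc_event :: ('n edge \<Rightarrow> bool) set)"
proof -
  let ?L = "\<lambda>m. {\<omega>. long_open {e. \<omega> e} m (0 :: int^'n)}"
  have "(\<lambda>m. measure (bfpp p) (?L m)) \<longlonglongrightarrow> measure (bfpp p) (\<Inter>m. ?L m)"
    by (rule bfpp.finite_Lim_measure_decseq)
      (auto simp: sets_long_open decseq_def intro: long_open_antimono)
  then have "\<delta> \<le> measure (bfpp p) (\<Inter>m. ?L m)"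
    by (rule LIMSEQ_le_const) (use assms in auto)
  also have "\<dots> \<le> measure (bfpp p) (perc_event :: ('n edge \<Rightarrow> bool) set)"
    by (rule bfpp.finite_measure_mono[OF _ sets_perc_event]) (auto simp: perc_event_eq)
  finally show ?thesis .
qed

text \<open>With all edges open, a coordinate axis percolates. This puts 1 into the set defining
  \<open>p_crit\<close>, so parameters below \<open>p_crit\<close> are below 1.\<close>

lemma measure_perc_event_one: "measure (bfpp 1) (perc_event :: (('n::finite) edge \<Rightarrow> bool) set) = 1"
proof -
  have "AE \<omega> in bfpp 1. \<omega> e" for e :: "'n edge"
  proof -
    have "emeasure (bfpp 1) {\<omega>. \<forall>e\<in>{e}. \<omega> e \<in> {True}} = 1"
      by (subst emeasure_bfpp_cylinder) (simp_all add: emeasure_pmf_single)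
    then have "measure (bfpp 1) {\<omega>. \<omega> e} = 1" by (simp add: measure_def)
    from bfpp.AE_prob_1[OF this] show ?thesis by simp
  qed
  then have "AE \<omega> in bfpp 1. \<forall>e :: 'n edge. \<omega> e" by (simp add: AE_all_countable)
  then have "AE \<omega> in bfpp 1. \<omega> \<in> (perc_event :: ('n edge \<Rightarrow> bool) set)"
  proof eventually_elim
    case (elim \<omega>)
    fix i :: 'n
    have "inj (\<lambda>k. axis i (int k))" by (auto simp: inj_on_def axis_eq_axis)
    moreover have "axis i (int (Suc k)) = axis i (int k) + axis i 1" for k
      by (auto simp: vec_eq_iff axis_def)
    then have "lat_adjacent (axis i (int k)) (axis i (int (Suc k)))" for k
      unfolding lat_adjacent_def by blast
    moreover have "\<omega> = (\<lambda>_. True)" using elim by (simp add: fun_eq_iff)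
    ultimately show ?case
      unfolding perc_event_def by (intro CollectI exI[of _ "\<lambda>k. axis i (int k)"]) auto
  qed
  then show ?thesis by (simp add: bfpp.prob_eq_1 sets_perc_event)
qed

lemma p_crit_le:
  assumes "0 \<le> p" "p \<le> 1" "0 < measure (bfpp p) (perc_event :: (('n::finite) edge \<Rightarrow> bool) set)"
  shows "p_crit TYPE('n) \<le> p"
  unfolding p_crit_def using assms by (intro cInf_lower bdd_belowI[of _ 0]) auto

lemma subcritical_exponential_decay:
  assumes "0 < q" "q < p_crit TYPE('n::finite)"
  shows "\<exists>p C \<rho>. q < p \<and> p < 1 \<and> 0 < \<rho> \<and> \<rho> < 1 \<and>
    (\<forall>m. measure (bfpp p) {\<omega>. long_open {e. \<omega> e} m (0 :: int^'n)} \<le> C * \<rho> ^ m)"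
proof -
  have "p_crit TYPE('n) \<le> 1" by (rule p_crit_le) (simp_all add: measure_perc_event_one)
  \<comment> \<open>From a to b runs the middle third between q and \<open>p_crit\<close>: decay is
    wanted strictly above q, and percolation at b < \<open>p_crit\<close> is the
    contradiction.\<close>
  define a where "a = (2 * q + p_crit TYPE('n)) / 3"
  define b where "b = (q + 2 * p_crit TYPE('n)) / 3"
  have ab: "q < a" "a < b" "b < p_crit TYPE('n)" using assms by (auto simp: a_def b_def)
  then have ab': "0 < a" "b < 1" using assms \<open>p_crit TYPE('n) \<le> 1\<close> by auto
  have "\<exists>p S. a \<le> p \<and> p \<le> b \<and> finite S \<and> (0 :: int^'n) \<in> S \<and> p * cut_exp p S < 1"
  proof (rule ccontr)
    assume "\<not> ?thesis"
    then have "1 \<le> p * cut_exp p S" if "a \<le> p" "p \<le> b" "finite S" "(0 :: int^'n) \<in> S" for p S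
      using that by force
    from long_open_prob_ge[OF ab'(1) ab(2) ab'(2) this]
    have "1 - a / (1 - a) * ((1 - b) / b) \<le> measure (bfpp b) (perc_event :: ('n edge \<Rightarrow> bool) set)"
      by (intro measure_perc_event_ge) auto
    \<comment> \<open>The map x / (1 - x) is increasing, so a < b leaves a positive lower
      bound.\<close>
    moreover have "a / (1 - a) * ((1 - b) / b) < 1"
      using ab ab' by (simp add: field_simps)
    ultimately have "0 < measure (bfpp b) (perc_event :: ('n edge \<Rightarrow> bool) set)" by linarith
    then have "p_crit TYPE('n) \<le> b" using ab ab' by (intro p_crit_le) auto
    then show False using ab by simp
  qed
  then obtain p and S :: "(int^'n) set" where p: "a \<le> p" "p \<le> b"
    and S: "finite S" "0 \<in> S" "p * cut_exp p S < 1" by blast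
  have "q < p" "p < 1" "0 \<le> p" "p \<le> 1" using p ab ab' by auto
  then show ?thesis using long_open_exponential_decay[OF _ _ S] by blast
qed

section \<open>Passage times\<close>

definition path_edges :: "(int^'n::finite) list \<Rightarrow> 'n edge list" where
  "path_edges \<gamma> = map (\<lambda>(u, v). lat_edge u v) (zip \<gamma> (tl \<gamma>))"

lemma length_path_edges [simp]: "length (path_edges \<gamma>) = length \<gamma> - 1"
  by (simp add: path_edges_def)

lemma path_edges_simps [simp]:
  "path_edges [] = []" "path_edges [x] = []"
  "path_edges (x # y # \<gamma>) = lat_edge x y # path_edges (y # \<gamma>)"
  by (simp_all add: path_edges_def)

lemma path_time_eq: "path_time \<omega> \<gamma> = sum_list (map (passage_time \<omega>) (path_edges \<gamma>))"
  by (simp add: path_time_def path_edges_def case_prod_unfold o_def)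

lemma path_time_eq_length_filter: "path_time \<omega> \<gamma> = length (filter (\<lambda>e. \<not> \<omega> e) (path_edges \<gamma>))"
proof -
  have "sum_list (map (passage_time \<omega>) es) = length (filter (\<lambda>e. \<not> \<omega> e) es)" for es
    by (induction es) (auto simp: passage_time_def)
  then show ?thesis by (simp add: path_time_eq)
qed

lemma path_edges_append: "path_edges (a @ x # b) = path_edges (a @ [x]) @ path_edges (x # b)"
proof (induction a)
  case (Cons y a)
  then show ?case by (cases a) auto
qed simp

lemma path_time_append: "path_time \<omega> (a @ x # b) = path_time \<omega> (a @ [x]) + path_time \<omega> (x # b)"
  unfolding path_time_eq by (subst path_edges_append) simp

lemma path_time_Cons: "\<gamma> \<noteq> [] \<Longrightarrow> path_time \<omega> \<gamma> \<le> path_time \<omega> (x # \<gamma>)"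
  by (cases \<gamma>) (auto simp: path_time_eq)

lemma path_time_Cons_mono:
  "\<gamma> \<noteq> [] \<Longrightarrow> \<gamma>' \<noteq> [] \<Longrightarrow> hd \<gamma> = hd \<gamma>' \<Longrightarrow> path_time \<omega> \<gamma> \<le> path_time \<omega> \<gamma>'
    \<Longrightarrow> path_time \<omega> (x # \<gamma>) \<le> path_time \<omega> (x # \<gamma>')"
  by (cases \<gamma>; cases \<gamma>') (auto simp: path_time_eq)

text \<open>Loop erasure does not increase the passage time, and the erased path is chosen before
  \<omega>. \<open>T_lat\<close> is an infimum over self-avoiding paths, whereas joining two
  geodesics yields only a walk.\<close>

lemma walk_contains_path:
  assumes "successively lat_adjacent \<gamma>" "\<gamma> \<noteq> []"
  shows "\<exists>\<gamma>'\<in>sa_paths (hd \<gamma>) (last \<gamma>). \<forall>\<omega>. path_time \<omega> \<gamma>' \<le> path_time \<omega> \<gamma>"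
  using assms
proof (induction \<gamma>)
  case (Cons x \<gamma>)
  show ?case
  proof (cases "\<gamma> = []")
    case True
    then show ?thesis by (intro bexI[of _ "[x]"]) (auto simp: sa_paths_def)
  next
    case False
    then have adj: "lat_adjacent x (hd \<gamma>)" "successively lat_adjacent \<gamma>"
      using Cons.prems by (auto simp: successively_Cons)
    then obtain \<gamma>' where \<gamma>': "\<gamma>' \<in> sa_paths (hd \<gamma>) (last \<gamma>)" "\<And>\<omega>. path_time \<omega> \<gamma>' \<le> path_time \<omega> \<gamma>"
      using Cons.IH False by blast
    show ?thesis
    proof (cases "x \<in> set \<gamma>'")
      case True
      then obtain a b where ab: "\<gamma>' = a @ x # b" by (auto simp: in_set_conv_decomp)
      have "x # b \<in> sa_paths x (last \<gamma>)"
        using \<gamma>'(1) unfolding ab sa_paths_def by (auto simp: successively_append_iff)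
      moreover have "path_time \<omega> (x # b) \<le> path_time \<omega> (x # \<gamma>)" for \<omega>
      proof -
        have "path_time \<omega> (x # b) \<le> path_time \<omega> \<gamma>'" using path_time_append[of \<omega> a x b] ab by simp
        also have "\<dots> \<le> path_time \<omega> \<gamma>" by (rule \<gamma>'(2))
        also have "\<dots> \<le> path_time \<omega> (x # \<gamma>)" by (rule path_time_Cons[OF False])
        finally show ?thesis .
      qed
      ultimately show ?thesis using False by auto
    next
      case x: False
      have "x # \<gamma>' \<in> sa_paths x (last \<gamma>)"
        using \<gamma>'(1) x adj(1) unfolding sa_paths_def by (auto simp: successively_Cons)
      moreover have "path_time \<omega> (x # \<gamma>') \<le> path_time \<omega> (x # \<gamma>)" for \<omega>
        using \<gamma>' False by (intro path_time_Cons_mono) (auto simp: sa_paths_def)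
      ultimately show ?thesis using False by auto
    qed
  qed
qed simp

lemma T_lat_le: "\<gamma> \<in> sa_paths x y \<Longrightarrow> T_lat \<omega> x y \<le> path_time \<omega> \<gamma>"
  unfolding T_lat_def by (intro cINF_lower) auto

lemma T_lat_le_walk:
  "successively lat_adjacent \<gamma> \<Longrightarrow> \<gamma> \<noteq> [] \<Longrightarrow> T_lat \<omega> (hd \<gamma>) (last \<gamma>) \<le> path_time \<omega> \<gamma>"
  by (drule (1) walk_contains_path) (blast intro: order_trans[OF T_lat_le])

definition lat_dist :: "int^'n::finite \<Rightarrow> int^'n \<Rightarrow> nat" where
  "lat_dist x y = (\<Sum>i\<in>UNIV. nat \<bar>y $ i - x $ i\<bar>)"

lemma lat_dist_step:
  assumes "lat_dist x y \<noteq> 0"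
  shows "\<exists>z. lat_adjacent x z \<and> lat_dist x y = Suc (lat_dist z y)"
proof -
  obtain i where i: "x $ i \<noteq> y $ i" using assms unfolding lat_dist_def by fastforce
  define z where "z = (if x $ i < y $ i then x + axis i 1 else x - axis i 1)"
  have "lat_adjacent x z" by (auto simp: z_def lat_adjacent_def)
  moreover have "lat_dist x y = Suc (lat_dist z y)"
  proof -
    have "z $ j = x $ j" if "j \<noteq> i" for j using that by (auto simp: z_def axis_def)
    then have "(\<Sum>j\<in>UNIV - {i}. nat \<bar>y $ j - x $ j\<bar>) = (\<Sum>j\<in>UNIV - {i}. nat \<bar>y $ j - z $ j\<bar>)"
      by (intro sum.cong) auto
    moreover have "nat \<bar>y $ i - x $ i\<bar> = Suc (nat \<bar>y $ i - z $ i\<bar>)"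
      using i by (auto simp: z_def axis_def)
    ultimately show ?thesis unfolding lat_dist_def by (simp add: sum.remove[of UNIV i])
  qed
  ultimately show ?thesis by blast
qed

lemma lattice_walk:
  "\<exists>\<gamma>. \<gamma> \<noteq> [] \<and> hd \<gamma> = x \<and> last \<gamma> = y \<and> successively lat_adjacent \<gamma> \<and> length \<gamma> = Suc (lat_dist x y)"
proof (induction "lat_dist x y" arbitrary: x)
  case 0
  then have "x = y" by (auto simp: lat_dist_def vec_eq_iff)
  then show ?case using 0 by (intro exI[of _ "[y]"]) auto
next
  case (Suc n)
  obtain z where z: "lat_adjacent x z" "lat_dist x y = Suc (lat_dist z y)"
    using lat_dist_step[of x y] Suc.hyps(2) by auto
  then obtain \<gamma> where "\<gamma> \<noteq> []" "hd \<gamma> = z" "last \<gamma> = y" "successively lat_adjacent \<gamma>"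
    "length \<gamma> = Suc (lat_dist z y)" using Suc.hyps(1)[of z] Suc.hyps(2) by auto
  then show ?case using z by (intro exI[of _ "x # \<gamma>"]) (auto simp: successively_Cons)
qed

lemma sa_paths_nonempty: "sa_paths x y \<noteq> {}"
  using lattice_walk[of x y] walk_contains_path by blast

text \<open>A nonempty set of naturals contains its infimum, so geodesics exist for every \<omega>;
  over an empty set of paths the infimum would carry no information.\<close>

lemma T_lat_attained: "\<exists>\<gamma>\<in>sa_paths x y. T_lat \<omega> x y = path_time \<omega> \<gamma>"
  using Inf_nat_def1[of "path_time \<omega> ` sa_paths x y"] sa_paths_nonempty unfolding T_lat_def by auto

lemma path_time_le_length: "path_time \<omega> \<gamma> \<le> length \<gamma> - 1"
  unfolding path_time_eq_length_filter by (rule order_trans[OF length_filter_le]) simp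

lemma T_lat_le_lat_dist: "T_lat \<omega> x y \<le> lat_dist x y"
proof -
  obtain \<gamma> where \<gamma>: "\<gamma> \<noteq> []" "hd \<gamma> = x" "last \<gamma> = y" "successively lat_adjacent \<gamma>"
    "length \<gamma> = Suc (lat_dist x y)" using lattice_walk by blast
  then show ?thesis using T_lat_le_walk[of \<gamma> \<omega>] path_time_le_length[of \<omega> \<gamma>] by simp
qed

lemma T_lat_triangle: "T_lat \<omega> x z \<le> T_lat \<omega> x y + T_lat \<omega> y z"
proof -
  obtain \<gamma>1 where \<gamma>1: "\<gamma>1 \<in> sa_paths x y" "T_lat \<omega> x y = path_time \<omega> \<gamma>1"
    using T_lat_attained by blast
  obtain \<gamma>2 where \<gamma>2: "\<gamma>2 \<in> sa_paths y z" "T_lat \<omega> y z = path_time \<omega> \<gamma>2"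
    using T_lat_attained by blast
  define a where "a = butlast \<gamma>1"
  define b where "b = tl \<gamma>2"
  have a: "\<gamma>1 = a @ [y]" and b: "\<gamma>2 = y # b"
    using \<gamma>1(1) \<gamma>2(1) append_butlast_last_id[of \<gamma>1] by (auto simp: sa_paths_def a_def b_def)
  have "successively lat_adjacent (a @ y # b)"
    using \<gamma>1(1) \<gamma>2(1) unfolding a b sa_paths_def by (auto simp: successively_append_iff)
  from T_lat_le_walk[OF this, of \<omega>] have "T_lat \<omega> (hd (a @ y # b)) (last (a @ y # b)) \<le> path_time \<omega> (a @ y # b)"
    by simp
  moreover have "hd (a @ y # b) = x" using \<gamma>1(1) unfolding a sa_paths_def by (cases a) auto
  moreover have "last (a @ y # b) = z" using \<gamma>2(1) unfolding b sa_paths_def by auto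
  ultimately show ?thesis using path_time_append[of \<omega> a y b] \<gamma>1(2) \<gamma>2(2) a b by simp
qed

lemma path_edges_shift:
  "successively lat_adjacent \<gamma> \<Longrightarrow> path_edges (map (\<lambda>u. u + w) \<gamma>) = map (shift_edge w) (path_edges \<gamma>)"
proof (induction \<gamma>)
  case (Cons x \<gamma>)
  then show ?case by (cases \<gamma>) (auto simp: lat_edge_shift)
qed simp

lemma T_lat_shift_le: "T_lat \<omega> (x + w) (y + w) \<le> T_lat (\<lambda>e. \<omega> (shift_edge w e)) x y"
proof -
  obtain \<gamma> where \<gamma>: "\<gamma> \<in> sa_paths x y"
    "T_lat (\<lambda>e. \<omega> (shift_edge w e)) x y = path_time (\<lambda>e. \<omega> (shift_edge w e)) \<gamma>"
    using T_lat_attained by blast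
  have "map (\<lambda>u. u + w) \<gamma> \<in> sa_paths (x + w) (y + w)"
    using \<gamma>(1) by (auto simp: sa_paths_def hd_map last_map distinct_map inj_on_def successively_map)
  then have "T_lat \<omega> (x + w) (y + w) \<le> path_time \<omega> (map (\<lambda>u. u + w) \<gamma>)" by (rule T_lat_le)
  also have "\<dots> = path_time (\<lambda>e. \<omega> (shift_edge w e)) \<gamma>"
    using \<gamma>(1) by (simp add: path_time_eq_length_filter path_edges_shift sa_paths_def filter_map o_def)
  finally show ?thesis using \<gamma>(2) by simp
qed

lemma T_lat_shift: "T_lat (\<lambda>e. \<omega> (shift_edge w e)) x y = T_lat \<omega> (x + w) (y + w)"
proof (rule antisym[OF _ T_lat_shift_le])
  have "shift_edge w (shift_edge (- w) e) = e" for e by (simp add: shift_edge_def)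
  then show "T_lat (\<lambda>e. \<omega> (shift_edge w e)) x y \<le> T_lat \<omega> (x + w) (y + w)"
    using T_lat_shift_le[of "\<lambda>e. \<omega> (shift_edge w e)" "x + w" "- w" "y + w"] by simp
qed

lemma T_lat_antimono:
  assumes "\<And>e. \<omega> e \<Longrightarrow> \<omega>' e"
  shows "T_lat \<omega>' x y \<le> T_lat \<omega> x y"
proof -
  obtain \<gamma> where \<gamma>: "\<gamma> \<in> sa_paths x y" "T_lat \<omega> x y = path_time \<omega> \<gamma>"
    using T_lat_attained by blast
  have "T_lat \<omega>' x y \<le> path_time \<omega>' \<gamma>" by (rule T_lat_le[OF \<gamma>(1)])
  also have "\<dots> \<le> path_time \<omega> \<gamma>"
    unfolding path_time_eq using assms by (intro sum_list_mono) (auto simp: passage_time_def)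
  finally show ?thesis using \<gamma>(2) by simp
qed

section \<open>Measurability of passage times\<close>

lemma measurable_path_time: "(\<lambda>\<omega>. path_time \<omega> \<gamma>) \<in> measurable (bfpp p) (count_space UNIV)"
proof -
  have 1: "(\<lambda>\<omega>. passage_time \<omega> e) \<in> measurable (bfpp p) (count_space UNIV)" for e
    unfolding passage_time_def by (intro measurable_If) (use sets_bfpp_component[of e True p] in auto)
  have "(\<lambda>\<omega>. sum_list (map (passage_time \<omega>) es)) \<in> measurable (bfpp p) (count_space UNIV)" for es
  proof (induction es)
    case (Cons e es)
    then show ?case
      using measurable_compose_countable[OF _ 1[of e],
        of "\<lambda>i \<omega>. i + sum_list (map (passage_time \<omega>) es)" "count_space UNIV"]
      by (simp add: measurable_compose[OF Cons])
  qed simp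
  then show ?thesis by (simp add: path_time_eq)
qed

lemma sets_path_time: "{\<omega>. P (path_time \<omega> \<gamma>)} \<in> sets (bfpp p)"
  using measurable_sets[OF measurable_path_time[of \<gamma> p], of "Collect P"] by (simp add: vimage_def)

text \<open>There are countably many paths, and the time equals k exactly when some path takes k and
  none takes less.\<close>

lemma measurable_T_lat: "(\<lambda>\<omega>. T_lat \<omega> x y) \<in> measurable (bfpp p) (count_space UNIV)"
proof -
  have "{\<omega>. T_lat \<omega> x y = k} \<in> sets (bfpp p)" for k
  proof -
    have "{\<omega>. T_lat \<omega> x y = k} = (\<Union>\<gamma>\<in>sa_paths x y. {\<omega>. path_time \<omega> \<gamma> = k})
        \<inter> (\<Inter>\<gamma>\<in>sa_paths x y. {\<omega>. k \<le> path_time \<omega> \<gamma>})"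
      (is "?L = ?R")
    proof (intro set_eqI iffI)
      fix \<omega> assume "\<omega> \<in> ?L"
      then show "\<omega> \<in> ?R" using T_lat_attained[of x y \<omega>] T_lat_le[of _ x y \<omega>] by force
    next
      fix \<omega> assume R: "\<omega> \<in> ?R"
      then obtain \<gamma>' where "\<gamma>' \<in> sa_paths x y" "path_time \<omega> \<gamma>' = k" by auto
      then have "T_lat \<omega> x y \<le> k" using T_lat_le by blast
      moreover obtain \<gamma> where "\<gamma> \<in> sa_paths x y" "T_lat \<omega> x y = path_time \<omega> \<gamma>"
        using T_lat_attained by blast
      then have "k \<le> T_lat \<omega> x y" using R by auto
      ultimately show "\<omega> \<in> ?L" by simp
    qed
    also have "\<dots> \<in> sets (bfpp p)"
      using sets.top[of "bfpp p"]
      by (intro sets.Int sets.countable_UN'' sets.countable_INT'' sets_path_time) auto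
    finally show ?thesis .
  qed
  then show ?thesis by (simp add: measurable_count_space_eq2_countable vimage_def)
qed

section \<open>Thinning, and paths with few closed edges\<close>

lemma emeasure_bfpp_UNIV [simp]: "emeasure (bfpp p) UNIV = 1"
  using bfpp.emeasure_space_1[of p] by simp

lemma measure_bfpp_UNIV [simp]: "measure (bfpp p) UNIV = 1"
  by (simp add: measure_def)

lemma emeasure_bfpp_all_open:
  assumes "finite J" "0 \<le> p" "p \<le> 1"
  shows "emeasure (bfpp p) {\<omega>. \<forall>e\<in>J. \<omega> e} = ennreal (p ^ card J)"
  using emeasure_bfpp_cylinder[OF assms(1), of p "\<lambda>_. {True}"] assms
  by (simp add: emeasure_pmf_single ennreal_power)

lemma emeasure_bfpp_closed:
  assumes "0 \<le> p" "p \<le> 1"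
  shows "emeasure (bfpp p) {\<omega>. \<not> \<omega> e} = ennreal (1 - p)"
  using emeasure_bfpp_cylinder[of "{e}" p "\<lambda>_. {False}"] assms
  by (simp add: emeasure_pmf_single)

lemma measurable_passage_time_thinned:
  "(\<lambda>\<eta>. ennreal (real (passage_time (\<lambda>e. \<omega> e \<and> \<eta> e) e))) \<in> borel_measurable (bfpp p)"
proof (cases "\<omega> e")
  case True
  have "(\<lambda>\<eta>. ennreal (real (passage_time (\<lambda>e. \<omega> e \<and> \<eta> e) e))) = indicator {\<eta>. \<eta> e = False}"
    using True by (auto simp: passage_time_def indicator_def fun_eq_iff)
  then show ?thesis using sets_bfpp_component[of e False p] by simp
next
  case False
  then show ?thesis by (simp add: passage_time_def)
qed

text \<open>A closed edge stays closed, and an open one is closed with probability 1 - r. Conceding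
  1 - r in both cases makes the sum over a path depend on its length only.\<close>

lemma nn_integral_passage_time_thinned:
  assumes "0 \<le> r" "r \<le> 1"
  shows "(\<integral>\<^sup>+\<eta>. ennreal (real (passage_time (\<lambda>e. \<omega> e \<and> \<eta> e) e)) \<partial>bfpp r)
    \<le> ennreal (real (passage_time \<omega> e) + (1 - r))"
proof (cases "\<omega> e")
  case True
  have "(\<lambda>\<eta>. ennreal (real (passage_time (\<lambda>e. \<omega> e \<and> \<eta> e) e))) = indicator {\<eta>. \<not> \<eta> e}"
    using True by (auto simp: passage_time_def indicator_def fun_eq_iff)
  then show ?thesis
    using True sets_bfpp_component[of e False r] emeasure_bfpp_closed[OF assms, of e]
    by (simp add: passage_time_def)
next
  case False
  have "(1 :: ennreal) \<le> ennreal (2 - r)" using assms by (simp add: ennreal_ge_1)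
  with False show ?thesis by (simp add: passage_time_def)
qed

lemma nn_integral_path_time_thinned:
  assumes "0 \<le> r" "r \<le> 1"
  shows "(\<integral>\<^sup>+\<eta>. ennreal (real (path_time (\<lambda>e. \<omega> e \<and> \<eta> e) \<gamma>)) \<partial>bfpp r)
    \<le> ennreal (real (path_time \<omega> \<gamma>) + (1 - r) * real (length \<gamma> - 1))"
proof -
  let ?t = "\<lambda>es \<eta>. ennreal (real (sum_list (map (passage_time (\<lambda>e. \<omega> e \<and> \<eta> e)) es)))"
  \<comment> \<open>Measurability is carried along, because splitting the integral of the sum needs
    it.\<close>
  have "?t es \<in> borel_measurable (bfpp r) \<and> (\<integral>\<^sup>+\<eta>. ?t es \<eta> \<partial>bfpp r)
    \<le> ennreal (real (sum_list (map (passage_time \<omega>) es)) + (1 - r) * real (length es))" for es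
  proof (induction es)
    case (Cons e es)
    have eq: "?t (e # es) = (\<lambda>\<eta>. ennreal (real (passage_time (\<lambda>e. \<omega> e \<and> \<eta> e) e)) + ?t es \<eta>)"
      by (simp add: fun_eq_iff)
    have "(\<integral>\<^sup>+\<eta>. ?t (e # es) \<eta> \<partial>bfpp r)
        = (\<integral>\<^sup>+\<eta>. ennreal (real (passage_time (\<lambda>e. \<omega> e \<and> \<eta> e) e)) \<partial>bfpp r) + (\<integral>\<^sup>+\<eta>. ?t es \<eta> \<partial>bfpp r)"
      unfolding eq using Cons by (intro nn_integral_add measurable_passage_time_thinned) auto
    also have "\<dots> \<le> ennreal (real (passage_time \<omega> e) + (1 - r))
        + ennreal (real (sum_list (map (passage_time \<omega>) es)) + (1 - r) * real (length es))"
      using Cons by (intro add_mono nn_integral_passage_time_thinned assms) auto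
    also have "\<dots> = ennreal (real (passage_time \<omega> e) + (1 - r)
        + (real (sum_list (map (passage_time \<omega>) es)) + (1 - r) * real (length es)))"
      using assms by (intro ennreal_plus[symmetric]) auto
    also have "\<dots> = ennreal (real (sum_list (map (passage_time \<omega>) (e # es))) + (1 - r) * real (length (e # es)))"
      by (simp add: algebra_simps)
    finally show ?case
      using Cons measurable_passage_time_thinned[of \<omega> e r] unfolding eq by auto
  qed simp
  from this[of "path_edges \<gamma>"] show ?thesis by (simp add: path_time_eq)
qed

text \<open>Fewer than m/k closed edges among m, written without division. For a geodesic the
  opposite inequality bounds its length by k times its passage time.\<close>

definition fast_path :: "nat \<Rightarrow> nat \<Rightarrow> (('n::finite) edge \<Rightarrow> bool) \<Rightarrow> bool" where
  "fast_path k m \<omega> \<longleftrightarrow> (\<exists>\<gamma>. length \<gamma> = Suc m \<and> hd \<gamma> = 0 \<and> distinct \<gamma>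
    \<and> successively lat_adjacent \<gamma> \<and> k * path_time \<omega> \<gamma> < m)"

lemma sets_fast_path: "{\<omega>. fast_path k m \<omega>} \<in> sets (bfpp p)"
proof -
  have "{\<omega>. fast_path k m \<omega>} = (\<Union>\<gamma>\<in>{\<gamma>. length \<gamma> = Suc m \<and> hd \<gamma> = 0 \<and> distinct \<gamma>
    \<and> successively lat_adjacent \<gamma>}. {\<omega>. k * path_time \<omega> \<gamma> < m})"
    by (auto simp: fast_path_def)
  also have "\<dots> \<in> sets (bfpp p)"
    by (intro sets.countable_UN'' sets_path_time[where P = "\<lambda>t. k * t < m"]) auto
  finally show ?thesis .
qed

lemma successively_open_step_path_edges:
  assumes "successively lat_adjacent \<gamma>" "set (path_edges \<gamma>) \<subseteq> A"
  shows "successively (open_step A UNIV) \<gamma>"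
  using assms
proof (induction \<gamma>)
  case (Cons x \<gamma>)
  then show ?case by (cases \<gamma>) (auto simp: open_step_def)
qed simp

text \<open>Opening every closed edge independently with probability at least \<open>\<sigma>\<^sup>k\<close> turns a
  path with fewer than \<open>m / k\<close> closed edges into an open one with probability at least \<open>\<sigma>\<^sup>m\<close>.\<close>

lemma fast_path_prob_le:
  assumes q: "0 \<le> q" "q \<le> q0" "q0 < p" "p < 1" and \<sigma>: "0 < \<sigma>" "\<sigma> < 1" "\<sigma> ^ k \<le> p - q0"
  shows "\<sigma> ^ m * measure (bfpp q) {\<omega>. fast_path k m (\<omega> :: ('n::finite) edge \<Rightarrow> bool)}
    \<le> measure (bfpp p) {\<omega>. long_open {e. \<omega> e} m (0 :: int^'n)}"
proof -
  let ?L = "{\<omega>. long_open {e. \<omega> e} m (0 :: int^'n)}"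
  let ?F = "{\<omega>. fast_path k m (\<omega> :: 'n edge \<Rightarrow> bool)}"
  \<comment> \<open>Opening closed edges with probability b raises the parameter from q to p, and b
    \<ge> p - q \<ge> p - q0 \<ge> \<sigma>^k.\<close>
  define b where "b = (p - q) / (1 - q)"
  have q1: "q < 1" using q by simp
  have b: "p - q \<le> b" "b \<le> 1" "0 \<le> b"
    using q q1 mult_left_mono[of "1 - q" 1 "p - q"] unfolding b_def by (auto simp: field_simps)
  have pq: "p = q + (1 - q) * b" using q1 by (simp add: b_def)
  have inner: "ennreal (\<sigma> ^ m) * indicator ?F \<omega>
      \<le> (\<integral>\<^sup>+\<eta>. indicator ?L (\<lambda>e. \<omega> e \<or> \<eta> e) \<partial>bfpp b)" for \<omega> :: "'n edge \<Rightarrow> bool"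
  proof (cases "fast_path k m \<omega>")
    case True
    then obtain \<gamma> where \<gamma>: "length \<gamma> = Suc m" "hd \<gamma> = 0" "distinct \<gamma>"
      "successively lat_adjacent \<gamma>" "k * path_time \<omega> \<gamma> < m" unfolding fast_path_def by blast
    \<comment> \<open>Opening these edges alone makes the whole path open; \<open>card J\<close> is
      at most the passage time, so k times it stays below m.\<close>
    define J where "J = set (filter (\<lambda>e. \<not> \<omega> e) (path_edges \<gamma>))"
    have J: "finite J" "card J \<le> path_time \<omega> \<gamma>"
      unfolding J_def path_time_eq_length_filter by (rule finite_set card_length)+
    have "\<sigma> ^ m \<le> \<sigma> ^ (k * card J)"
    proof (rule power_decreasing)
      have "k * card J \<le> k * path_time \<omega> \<gamma>" using J(2) by simp
      then show "k * card J \<le> m" using \<gamma>(5) by linarith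
    qed (use \<sigma> in auto)
    also have "\<dots> = (\<sigma> ^ k) ^ card J" by (simp add: power_mult)
    also have "\<dots> \<le> b ^ card J" using \<sigma> b q by (intro power_mono) auto
    finally have "ennreal (\<sigma> ^ m) \<le> emeasure (bfpp b) {\<eta>. \<forall>e\<in>J. \<eta> e}"
      using emeasure_bfpp_all_open[OF J(1) b(3,2)] by (simp add: ennreal_leI)
    also have "\<dots> = (\<integral>\<^sup>+\<eta>. indicator {\<eta>. \<forall>e\<in>J. \<eta> e} \<eta> \<partial>bfpp b)"
    proof (rule nn_integral_indicator[symmetric])
      have "{\<eta>. \<forall>e\<in>J. \<eta> e} = {\<eta>. {e\<in>J. \<eta> e} = J}" by auto
      then show "{\<eta>. \<forall>e\<in>J. \<eta> e} \<in> sets (bfpp b)"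
        using sets_bfpp_finite[OF J(1), of "\<lambda>A. A = J" b] by simp
    qed
    also have "\<dots> \<le> (\<integral>\<^sup>+\<eta>. indicator ?L (\<lambda>e. \<omega> e \<or> \<eta> e) \<partial>bfpp b)"
    proof (rule nn_integral_mono)
      fix \<eta>
      have "long_open {e. \<omega> e \<or> \<eta> e} m 0" if "\<forall>e\<in>J. \<eta> e"
      proof -
        have "set (path_edges \<gamma>) \<subseteq> {e. \<omega> e \<or> \<eta> e}" using that by (auto simp: J_def)
        from successively_open_step_path_edges[OF \<gamma>(4) this] show ?thesis
          unfolding long_open_def using \<gamma> by blast
      qed
      then show "indicator {\<eta>. \<forall>e\<in>J. \<eta> e} \<eta> \<le> (indicator ?L (\<lambda>e. \<omega> e \<or> \<eta> e) :: ennreal)"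
        by (auto simp: indicator_def)
    qed
    finally show ?thesis using True by simp
  qed simp
  have "ennreal (\<sigma> ^ m) * emeasure (bfpp q) ?F = (\<integral>\<^sup>+\<omega>. ennreal (\<sigma> ^ m) * indicator ?F \<omega> \<partial>bfpp q)"
    by (simp add: nn_integral_cmult_indicator sets_fast_path)
  also have "\<dots> \<le> (\<integral>\<^sup>+\<omega>. \<integral>\<^sup>+\<eta>. indicator ?L (\<lambda>e. \<omega> e \<or> \<eta> e) \<partial>bfpp b \<partial>bfpp q)"
    by (rule nn_integral_mono) (rule inner)
  also have "\<dots> = (\<integral>\<^sup>+\<omega>. indicator ?L \<omega> \<partial>bfpp p)"
    unfolding pq
    by (intro nn_integral_bfpp_coupling[where h = "(\<or>)", symmetric] bernoulli_pmf_disj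
        borel_measurable_indicator sets_long_open) (use q q1 b in auto)
  also have "\<dots> = emeasure (bfpp p) ?L" by (rule nn_integral_indicator[OF sets_long_open])
  finally have "ennreal (\<sigma> ^ m * measure (bfpp q) ?F) \<le> ennreal (measure (bfpp p) ?L)"
    using \<sigma> by (simp add: bfpp.emeasure_eq_measure ennreal_mult)
  then show ?thesis by (simp add: ennreal_le_iff)
qed

section \<open>Expected passage times between lattice points\<close>

definition exp_lat :: "real \<Rightarrow> int^'n::finite \<Rightarrow> int^'n \<Rightarrow> real" where
  "exp_lat p x y = integral\<^sup>L (bfpp p) (\<lambda>\<omega>. real (T_lat \<omega> x y))"

lemma measurable_real_T_lat: "(\<lambda>\<omega>. real (T_lat \<omega> x y)) \<in> borel_measurable (bfpp p)"
  by (rule measurable_compose[OF measurable_T_lat]) simp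

lemma integrable_T_lat: "integrable (bfpp p) (\<lambda>\<omega>. real (T_lat \<omega> x y))"
  by (rule bfpp.integrable_const_bound[where B = "real (lat_dist x y)"])
    (auto simp: T_lat_le_lat_dist measurable_real_T_lat)

lemma ennreal_exp_lat: "ennreal (exp_lat p x y) = (\<integral>\<^sup>+\<omega>. ennreal (real (T_lat \<omega> x y)) \<partial>bfpp p)"
  unfolding exp_lat_def by (rule nn_integral_eq_integral[OF integrable_T_lat, symmetric]) simp

lemma exp_lat_nonneg: "0 \<le> exp_lat p x y"
  unfolding exp_lat_def by simp

lemma exp_lat_le_lat_dist:
  fixes x y :: "int^'n::finite"
  shows "exp_lat p x y \<le> real (lat_dist x y)"
proof -
  have "exp_lat p x y \<le> integral\<^sup>L (bfpp p) (\<lambda>_ :: 'n edge \<Rightarrow> bool. real (lat_dist x y))"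
    unfolding exp_lat_def by (intro integral_mono integrable_T_lat) (auto simp: T_lat_le_lat_dist)
  then show ?thesis by simp
qed

lemma exp_lat_triangle: "exp_lat p x z \<le> exp_lat p x y + exp_lat p y z"
proof -
  have "exp_lat p x z \<le> integral\<^sup>L (bfpp p) (\<lambda>\<omega>. real (T_lat \<omega> x y) + real (T_lat \<omega> y z))"
    unfolding exp_lat_def
    by (intro integral_mono integrable_T_lat Bochner_Integration.integrable_add)
      (simp add: T_lat_triangle flip: of_nat_add)
  then show ?thesis by (simp add: exp_lat_def integrable_T_lat)
qed

lemma exp_lat_shift: "exp_lat p (x + w) (y + w) = exp_lat p x y"
proof -
  let ?f = "\<lambda>\<omega> e. \<omega> (shift_edge w e)"
  have f: "?f \<in> measurable (bfpp p) (bfpp p)"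
    by (intro measurable_into_bfpp measurable_bfpp_component)
  have "exp_lat p x y = integral\<^sup>L (distr (bfpp p) (bfpp p) ?f) (\<lambda>\<omega>. real (T_lat \<omega> x y))"
    by (simp add: exp_lat_def distr_bfpp_reindex[OF inj_shift_edge])
  also have "\<dots> = exp_lat p (x + w) (y + w)"
    by (simp add: integral_distr[OF f measurable_real_T_lat] T_lat_shift exp_lat_def)
  finally show ?thesis ..
qed

lemma nn_integral_T_lat_thinned:
  assumes "0 \<le> q" "q \<le> 1" "0 \<le> r" "r \<le> 1"
  shows "ennreal (exp_lat (q * r) x y)
    = (\<integral>\<^sup>+\<omega>. \<integral>\<^sup>+\<eta>. ennreal (real (T_lat (\<lambda>e. \<omega> e \<and> \<eta> e) x y)) \<partial>bfpp r \<partial>bfpp q)"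
  unfolding ennreal_exp_lat
  by (rule nn_integral_bfpp_coupling[where h = "(\<and>)", OF bernoulli_pmf_conj[OF assms]])
    (intro measurable_compose[OF measurable_real_T_lat measurable_ennreal])

lemma exp_lat_antimono:
  fixes x y :: "int^'n::finite"
  assumes "0 < q" "p \<le> q" "q \<le> 1" "0 \<le> p"
  shows "exp_lat q x y \<le> exp_lat p x y"
proof -
  have r: "0 \<le> p / q" "p / q \<le> 1" "p = q * (p / q)" using assms by auto
  have "ennreal (exp_lat q x y) = (\<integral>\<^sup>+\<omega>. \<integral>\<^sup>+\<eta>. ennreal (real (T_lat \<omega> x y))
      \<partial>(bfpp (p / q) :: ('n edge \<Rightarrow> bool) measure) \<partial>bfpp q)"
    by (simp add: ennreal_exp_lat)
  also have "\<dots> \<le> (\<integral>\<^sup>+\<omega>. \<integral>\<^sup>+\<eta>. ennreal (real (T_lat (\<lambda>e. \<omega> e \<and> \<eta> e) x y)) \<partial>bfpp (p / q) \<partial>bfpp q)"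
    by (intro nn_integral_mono ennreal_leI of_nat_mono T_lat_antimono) auto
  also have "\<dots> = ennreal (exp_lat p x y)"
    using nn_integral_T_lat_thinned[of q "p / q" x y] assms r by simp
  finally show ?thesis by (simp add: ennreal_le_iff exp_lat_nonneg)
qed

text \<open>For fixed \<omega> take a geodesic with m edges. Thinning raises its time on average by
  at most (1 - r) m. Either m is at most k times the passage time, or the geodesic is itself a fast
  path; then m is bounded by \<open>R\<close>, whose mean is at most the series on the right,
  uniformly in the endpoint.\<close>

lemma exp_lat_thinned_le:
  fixes v :: "int^'n::finite"
  assumes q: "0 \<le> q" "q \<le> 1" "0 \<le> r" "r \<le> 1" and \<sigma>: "0 \<le> \<sigma>" "\<sigma> < 1" and C: "0 \<le> C"
    and fast: "\<And>m. measure (bfpp q) {\<omega>. fast_path k m (\<omega> :: 'n edge \<Rightarrow> bool)} \<le> C * \<sigma> ^ m"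
  shows "exp_lat (q * r) 0 v \<le> exp_lat q 0 v
    + (1 - r) * (real k * exp_lat q 0 v + (\<Sum>m. real m * (C * \<sigma> ^ m)))"
proof -
  let ?T = "\<lambda>\<omega>. T_lat \<omega> 0 v"
  let ?D = "\<Sum>m. real m * (C * \<sigma> ^ m)"
  \<comment> \<open>The sum of all m for which a fast path with m edges exists; the length of a fast
    geodesic is one of its terms. Working in \<open>ennreal\<close> defers questions of
    finiteness.\<close>
  define R where "R \<omega> = (\<Sum>m. ennreal (real m) * indicator {\<omega>. fast_path k m (\<omega> :: 'n edge \<Rightarrow> bool)} \<omega>)" for \<omega>
  have R_meas: "R \<in> borel_measurable (bfpp q)"
    unfolding R_def by (intro borel_measurable_suminf_order borel_measurable_times_ennreal
        borel_measurable_indicator sets_fast_path borel_measurable_const)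
  have T_meas: "(\<lambda>\<omega>. ennreal (real (?T \<omega>))) \<in> borel_measurable (bfpp q)"
    by (intro measurable_compose[OF measurable_real_T_lat measurable_ennreal])
  have inner: "(\<integral>\<^sup>+\<eta>. ennreal (real (?T (\<lambda>e. \<omega> e \<and> \<eta> e))) \<partial>bfpp r)
    \<le> ennreal (real (?T \<omega>)) + ennreal (1 - r) * (ennreal (real k) * ennreal (real (?T \<omega>)) + R \<omega>)" for \<omega>
  proof -
    obtain \<gamma> where \<gamma>: "\<gamma> \<in> sa_paths 0 v" "?T \<omega> = path_time \<omega> \<gamma>" using T_lat_attained by blast
    define m where "m = length \<gamma> - 1"
    have len: "length \<gamma> = Suc m" using \<gamma>(1) by (cases \<gamma>) (auto simp: sa_paths_def m_def)
    have m: "ennreal (real m) \<le> ennreal (real k) * ennreal (real (?T \<omega>)) + R \<omega>"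
    proof (cases "k * path_time \<omega> \<gamma> < m")
      case True
      then have "fast_path k m \<omega>" using \<gamma>(1) len unfolding fast_path_def sa_paths_def by blast
      then have "ennreal (real m) = (\<Sum>m\<in>{m}. ennreal (real m) * indicator {\<omega>. fast_path k m \<omega>} \<omega>)" by simp
      also have "\<dots> \<le> R \<omega>" unfolding R_def by (intro sum_le_suminf) auto
      finally show ?thesis by (simp add: add_increasing)
    next
      case False
      then have "real m \<le> real k * real (?T \<omega>)" using \<gamma>(2) by (simp flip: of_nat_mult)
      then have "ennreal (real m) \<le> ennreal (real k) * ennreal (real (?T \<omega>))"
        by (simp add: ennreal_leI flip: ennreal_mult)
      then show ?thesis by (simp add: add_increasing2)
    qed
    have "(\<integral>\<^sup>+\<eta>. ennreal (real (?T (\<lambda>e. \<omega> e \<and> \<eta> e))) \<partial>bfpp r)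
        \<le> (\<integral>\<^sup>+\<eta>. ennreal (real (path_time (\<lambda>e. \<omega> e \<and> \<eta> e) \<gamma>)) \<partial>bfpp r)"
      by (intro nn_integral_mono ennreal_leI of_nat_mono T_lat_le \<gamma>(1))
    also have "\<dots> \<le> ennreal (real (path_time \<omega> \<gamma>) + (1 - r) * real (length \<gamma> - 1))"
      by (rule nn_integral_path_time_thinned[OF q(3,4)])
    also have "\<dots> = ennreal (real (?T \<omega>)) + ennreal (1 - r) * ennreal (real m)"
      using q by (simp add: \<gamma>(2) m_def ennreal_mult)
    also have "\<dots> \<le> ennreal (real (?T \<omega>)) + ennreal (1 - r) * (ennreal (real k) * ennreal (real (?T \<omega>)) + R \<omega>)"
      using m by (intro add_left_mono mult_left_mono) auto
    finally show ?thesis .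
  qed
  have summable: "summable (\<lambda>m. real m * (C * \<sigma> ^ m))"
  proof -
    have "summable (\<lambda>m. C * (of_nat (Suc m) * \<sigma> ^ m))"
      using sums_summable[OF geometric_deriv_sums[of \<sigma>]] \<sigma> by (intro summable_mult) auto
    then show ?thesis
    proof (rule summable_comparison_test'[where N = 0])
      fix m :: nat
      have "real m * (C * \<sigma> ^ m) \<le> real (Suc m) * (C * \<sigma> ^ m)" using C \<sigma> by (intro mult_right_mono) auto
      then show "norm (real m * (C * \<sigma> ^ m)) \<le> C * (of_nat (Suc m) * \<sigma> ^ m)"
        using C \<sigma> by (simp add: mult_ac)
    qed
  qed
  have "(\<integral>\<^sup>+\<omega>. R \<omega> \<partial>bfpp q)
      = (\<Sum>m. \<integral>\<^sup>+\<omega>. ennreal (real m) * indicator {\<omega>. fast_path k m (\<omega> :: 'n edge \<Rightarrow> bool)} \<omega> \<partial>bfpp q)"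
    unfolding R_def by (intro nn_integral_suminf borel_measurable_times_ennreal
        borel_measurable_indicator sets_fast_path borel_measurable_const)
  also have "\<dots> = (\<Sum>m. ennreal (real m * measure (bfpp q) {\<omega>. fast_path k m (\<omega> :: 'n edge \<Rightarrow> bool)}))"
    by (simp add: nn_integral_cmult_indicator sets_fast_path bfpp.emeasure_eq_measure ennreal_mult)
  also have "\<dots> \<le> (\<Sum>m. ennreal (real m * (C * \<sigma> ^ m)))"
    using fast by (intro suminf_le ennreal_leI mult_left_mono) auto
  also have "\<dots> = ennreal ?D"
    using C \<sigma> by (intro suminf_ennreal2 summable) auto
  finally have R: "(\<integral>\<^sup>+\<omega>. R \<omega> \<partial>bfpp q) \<le> ennreal ?D" .
  have D: "0 \<le> ?D" using C \<sigma> by (intro suminf_nonneg summable) auto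
  have "ennreal (exp_lat (q * r) 0 v) \<le> (\<integral>\<^sup>+\<omega>. ennreal (real (?T \<omega>))
      + ennreal (1 - r) * (ennreal (real k) * ennreal (real (?T \<omega>)) + R \<omega>) \<partial>bfpp q)"
    unfolding nn_integral_T_lat_thinned[OF q] by (rule nn_integral_mono) (rule inner)
  also have "\<dots> = ennreal (exp_lat q 0 v)
      + ennreal (1 - r) * (ennreal (real k) * ennreal (exp_lat q 0 v) + (\<integral>\<^sup>+\<omega>. R \<omega> \<partial>bfpp q))"
    using R_meas T_meas by (simp add: nn_integral_add nn_integral_cmult ennreal_exp_lat)
  also have "\<dots> \<le> ennreal (exp_lat q 0 v)
      + ennreal (1 - r) * (ennreal (real k) * ennreal (exp_lat q 0 v) + ennreal ?D)"
    using R by (intro add_left_mono mult_left_mono) auto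
  also have "\<dots> = ennreal (exp_lat q 0 v + (1 - r) * (real k * exp_lat q 0 v + ?D))"
    using q D exp_lat_nonneg[of q 0 v] by (simp add: ennreal_plus ennreal_mult)
  finally show ?thesis
    using q D exp_lat_nonneg[of q 0 v] by (subst (asm) ennreal_le_iff) auto
qed

text \<open>Decay at a single parameter above q0 controls every q \<le> q0, so K and D are chosen
  before p, q and v. The bound q0 < 1 is recorded for the monotonicity of
  \<open>time_const\<close>.\<close>

lemma exp_lat_difference:
  assumes "0 < q0" "q0 < p_crit TYPE('n::finite)"
  shows "q0 < 1 \<and> (\<exists>(K::real) D. 0 < K \<and> (\<forall>p q. \<forall>v :: int^'n. 0 < p \<longrightarrow> p \<le> q \<longrightarrow> q \<le> q0 \<longrightarrow>
    exp_lat p 0 v \<le> exp_lat q 0 v + (q - p) / q * (K * exp_lat q 0 v + D)))"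
proof -
  obtain p' C \<rho> where p': "q0 < p'" "p' < 1" and \<rho>: "0 < \<rho>" "\<rho> < 1"
    and decay: "\<And>m. measure (bfpp p') {\<omega>. long_open {e. \<omega> e} m (0 :: int^'n)} \<le> C * \<rho> ^ m"
    using subcritical_exponential_decay[OF assms] by blast
  \<comment> \<open>Half of the decay exponent pays for opening closed edges, the other half
    remains.\<close>
  define \<sigma> where "\<sigma> = sqrt \<rho>"
  have \<sigma>: "0 < \<sigma>" "\<sigma> < 1" "\<rho> = \<sigma> * \<sigma>" using \<rho> by (auto simp: \<sigma>_def)
  obtain k where k: "\<sigma> ^ k < p' - q0" using real_arch_pow_inv[of "p' - q0" \<sigma>] p' \<sigma> by auto
  \<comment> \<open>\<open>Suc k\<close> instead of \<open>k\<close>, since this number becomes K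
    and must be positive.\<close>
  have "\<sigma> ^ Suc k \<le> \<sigma> ^ k" using \<sigma> by (intro power_decreasing) auto
  then have k': "\<sigma> ^ Suc k \<le> p' - q0" using k by simp
  have C: "0 \<le> C" using decay[of 0] order_trans[OF measure_nonneg] by fastforce
  let ?D = "\<Sum>m. real m * (C * \<sigma> ^ m)"
  have "exp_lat p 0 v \<le> exp_lat q 0 v + (q - p) / q * (real (Suc k) * exp_lat q 0 v + ?D)"
    if pq: "0 < p" "p \<le> q" "q \<le> q0" for p q and v :: "int^'n"
  proof -
    have fast: "measure (bfpp q) {\<omega>. fast_path (Suc k) m (\<omega> :: 'n edge \<Rightarrow> bool)} \<le> C * \<sigma> ^ m" for m
    proof -
      have "\<sigma> ^ m * measure (bfpp q) {\<omega>. fast_path (Suc k) m (\<omega> :: 'n edge \<Rightarrow> bool)} \<le> C * \<rho> ^ m"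
        using pq by (intro order_trans[OF fast_path_prob_le[OF _ pq(3) p' \<sigma>(1,2) k'] decay]) auto
      also have "\<dots> = \<sigma> ^ m * (C * \<sigma> ^ m)" by (simp add: \<sigma>(3) power_mult_distrib)
      finally show ?thesis using \<sigma>(1) by simp
    qed
    have "exp_lat (q * (p / q)) 0 v \<le> exp_lat q 0 v + (1 - p / q) * (real (Suc k) * exp_lat q 0 v + ?D)"
      using pq p' \<sigma> by (intro exp_lat_thinned_le C fast) auto
    moreover have "1 - p / q = (q - p) / q" "q * (p / q) = p" using pq by (auto simp: field_simps)
    ultimately show ?thesis by simp
  qed
  then show ?thesis using p' by (intro conjI exI[of _ "real (Suc k)"] exI[of _ ?D]) auto
qed

section \<open>The time constant\<close>

text \<open>Fekete's lemma: a + c is genuinely subadditive, and c / n vanishes. The defect c will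
  come from rounding real points to lattice points.\<close>

lemma almost_subadditive_converges:
  fixes a :: "nat \<Rightarrow> real"
  assumes sub: "\<And>m n. a (m + n) \<le> a m + a n + c" and nonneg: "\<And>n. 0 \<le> a n" and c: "0 \<le> c"
  shows "convergent (\<lambda>n. a n / real n)"
proof -
  define b where "b n = a n + c" for n
  have b_sub: "b (m + n) \<le> b m + b n" for m n using sub[of m n] by (simp add: b_def)
  have b_nonneg: "0 \<le> b n" for n using nonneg[of n] c by (simp add: b_def)
  have b_mult: "b (k * N + r) \<le> real k * b N + b r" for k N r
  proof (induction k)
    case (Suc k)
    then show ?case using b_sub[of N "k * N + r"] by (simp add: algebra_simps)
  qed simp
  define L where "L = (INF n\<in>{1..}. b n / real n)"
  have bdd: "bdd_below ((\<lambda>n. b n / real n) ` {1..})"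
    by (intro bdd_belowI2[where m = 0]) (simp add: b_nonneg)
  have lower: "L \<le> b n / real n" if "1 \<le> n" for n
    unfolding L_def using that by (intro cINF_lower bdd) auto
  have "(\<lambda>n. b n / real n) \<longlonglongrightarrow> L"
  proof (rule LIMSEQ_I)
    fix \<epsilon> :: real assume \<epsilon>: "0 < \<epsilon>"
    have "\<exists>N\<in>{1..}. b N / real N < L + \<epsilon> / 2"
      using \<epsilon> cINF_less_iff[OF _ bdd, of "L + \<epsilon> / 2"] unfolding L_def by fastforce
    then obtain N where N: "1 \<le> N" "b N / real N < L + \<epsilon> / 2" by auto
    \<comment> \<open>A common bound for the remainders n mod N, including 0, where
      \<open>b 0\<close> need not vanish.\<close>
    define M where "M = (\<Sum>r<N. b r)"
    have M: "b r \<le> M" if "r < N" for r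
      unfolding M_def using that by (intro member_le_sum) (auto simp: b_nonneg)
    have M0: "0 \<le> M" unfolding M_def by (intro sum_nonneg b_nonneg)
    obtain n0 :: nat where n0: "2 * M / \<epsilon> < real n0" using reals_Archimedean2 by blast
    show "\<exists>n0. \<forall>n\<ge>n0. norm (b n / real n - L) < \<epsilon>"
    proof (intro exI[of _ "max 1 n0"] allI impI)
      fix n assume n: "max 1 n0 \<le> n"
      have "b n = b (n div N * N + n mod N)" by simp
      also have "\<dots> \<le> real (n div N) * b N + b (n mod N)" by (rule b_mult)
      also have "\<dots> \<le> real n * (b N / real N) + M"
      proof (intro add_mono M)
        have "real (n div N) * real N \<le> real n"
          by (simp only: of_nat_mult[symmetric] of_nat_le_iff div_times_less_eq_dividend)
        then have "real (n div N) * real N * (b N / real N) \<le> real n * (b N / real N)"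
          using b_nonneg[of N] by (intro mult_right_mono) auto
        then show "real (n div N) * b N \<le> real n * (b N / real N)" using N(1) by simp
      qed (use N in auto)
      finally have "b n / real n \<le> (real n * (b N / real N) + M) / real n"
        by (intro divide_right_mono) auto
      also have "\<dots> = b N / real N + M / real n" using n by (simp add: add_divide_distrib)
      finally have "b n / real n \<le> b N / real N + M / real n" .
      moreover have "M / real n < \<epsilon> / 2"
      proof -
        have "2 * M / \<epsilon> < real n" using n0 n by simp
        then show ?thesis using \<epsilon> n by (simp add: field_simps)
      qed
      ultimately have "b n / real n < L + \<epsilon>" using N(2) by linarith
      moreover have "L \<le> b n / real n" using n by (intro lower) auto
      ultimately show "norm (b n / real n - L) < \<epsilon>" by simp
    qed
  qed
  moreover have "(\<lambda>n. c / real n) \<longlonglongrightarrow> 0" by (rule lim_const_over_n)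
  ultimately have "(\<lambda>n. b n / real n - c / real n) \<longlonglongrightarrow> L - 0" by (rule tendsto_diff)
  then show ?thesis by (auto simp: b_def convergent_def diff_divide_distrib[symmetric])
qed

lemma exp_passage_eq:
  fixes x :: "real^'n::finite"
  shows "exp_passage p x = exp_lat p 0 (lattice_point x)"
proof -
  have "lattice_point (0 :: real^'n) = 0" by (simp add: lattice_point_def vec_eq_iff)
  then show ?thesis by (simp add: exp_passage_def exp_lat_def passage_def)
qed

text \<open>Rounding x + y differs from adding the rounded points by 0 or 1 in each coordinate, so
  the correction takes at most d steps. Translation invariance moves the second leg to the
  origin.\<close>

lemma exp_passage_almost_subadditive:
  fixes x y :: "real^'n::finite"
  shows "exp_passage p (x + y) \<le> exp_passage p x + exp_passage p y + real CARD('n)"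
proof -
  let ?u = "lattice_point x" and ?v = "lattice_point y" and ?w = "lattice_point (x + y)"
  have "exp_lat p 0 ?w \<le> exp_lat p 0 ?u + exp_lat p ?u ?w" by (rule exp_lat_triangle)
  also have "exp_lat p ?u ?w = exp_lat p 0 (?w - ?u)"
    using exp_lat_shift[of p 0 ?u "?w - ?u"] by simp
  also have "\<dots> \<le> exp_lat p 0 ?v + exp_lat p ?v (?w - ?u)" by (rule exp_lat_triangle)
  also have "exp_lat p ?v (?w - ?u) \<le> real (lat_dist ?v (?w - ?u))" by (rule exp_lat_le_lat_dist)
  also have "lat_dist ?v (?w - ?u) \<le> (\<Sum>i\<in>(UNIV :: 'n set). 1)"
    unfolding lat_dist_def
  proof (rule sum_mono)
    fix i :: 'n
    show "nat \<bar>(?w - ?u) $ i - ?v $ i\<bar> \<le> 1"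
      unfolding lattice_point_def by simp linarith
  qed
  finally show ?thesis by (simp add: exp_passage_eq)
qed

text \<open>\<open>time_const\<close> is defined by \<open>lim\<close>, which is informative only
  once the limit exists; almost subadditivity supplies this for every real vector x.\<close>

lemma time_const_tendsto:
  fixes x :: "real^'n::finite"
  shows "(\<lambda>n. exp_passage p (real n *\<^sub>R x) / real n) \<longlonglongrightarrow> time_const p x"
proof -
  have "convergent (\<lambda>n. exp_passage p (real n *\<^sub>R x) / real n)"
  proof (rule almost_subadditive_converges)
    show "exp_passage p (real (m + n) *\<^sub>R x)
      \<le> exp_passage p (real m *\<^sub>R x) + exp_passage p (real n *\<^sub>R x) + real CARD('n)" for m n
      using exp_passage_almost_subadditive[of p "real m *\<^sub>R x" "real n *\<^sub>R x"]
      by (simp add: scaleR_left_distrib)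
  qed (auto simp: exp_passage_eq exp_lat_nonneg)
  then show ?thesis unfolding time_const_def by (simp add: convergent_LIMSEQ_iff)
qed

lemma time_const_nonneg: "0 \<le> time_const p x"
  by (rule LIMSEQ_le_const[OF time_const_tendsto]) (auto simp: exp_passage_eq exp_lat_nonneg)

lemma time_const_antimono:
  assumes "0 < q" "p \<le> q" "q \<le> 1" "0 \<le> p"
  shows "time_const q x \<le> time_const p x"
  by (rule LIMSEQ_le[OF time_const_tendsto time_const_tendsto])
    (auto simp: exp_passage_eq intro!: divide_right_mono exp_lat_antimono assms)

text \<open>D does not depend on the endpoint, so D / n disappears in the limit. Allowing p = q
  saves a case distinction in the Lipschitz part.\<close>

lemma time_const_difference:
  assumes "0 < q0" "q0 < p_crit TYPE('n::finite)"
  shows "\<exists>K>0. \<forall>p q. \<forall>x :: real^'n. 0 < p \<longrightarrow> p \<le> q \<longrightarrow> q \<le> q0 \<longrightarrow>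
    time_const p x - time_const q x \<le> K * time_const q x / q * (q - p)"
proof -
  obtain K D :: real where K: "0 < K" and le: "\<And>p q. \<And>v :: int^'n. 0 < p \<Longrightarrow> p \<le> q \<Longrightarrow> q \<le> q0 \<Longrightarrow>
    exp_lat p 0 v \<le> exp_lat q 0 v + (q - p) / q * (K * exp_lat q 0 v + D)"
    using exp_lat_difference[OF assms] by blast
  have "time_const p x - time_const q x \<le> K * time_const q x / q * (q - p)"
    if pq: "0 < p" "p \<le> q" "q \<le> q0" for p q and x :: "real^'n"
  proof -
    let ?a = "\<lambda>p n. exp_passage p (real n *\<^sub>R x) / real n"
    have "time_const p x \<le> time_const q x + (q - p) / q * (K * time_const q x + 0)"
    proof (rule LIMSEQ_le[OF time_const_tendsto])
      show "(\<lambda>n. ?a q n + (q - p) / q * (K * ?a q n + D / real n))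
          \<longlonglongrightarrow> time_const q x + (q - p) / q * (K * time_const q x + 0)"
        by (intro tendsto_add tendsto_mult tendsto_const time_const_tendsto lim_const_over_n)
      have "?a p n \<le> ?a q n + (q - p) / q * (K * ?a q n + D / real n)" for n
      proof -
        have "?a p n \<le> (exp_passage q (real n *\<^sub>R x)
            + (q - p) / q * (K * exp_passage q (real n *\<^sub>R x) + D)) / real n"
          unfolding exp_passage_eq by (intro divide_right_mono le pq) simp
        then show ?thesis by (simp only: add_divide_distrib times_divide_eq_right[symmetric])
      qed
      then show "\<exists>N. \<forall>n\<ge>N. ?a p n \<le> ?a q n + (q - p) / q * (K * ?a q n + D / real n)" by blast
    qed
    then show ?thesis by (simp add: mult_ac)
  qed
  then show ?thesis using K by blast
qed

theorem theorem2:
  fixes q0 :: real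
  assumes "CARD('n::finite) \<ge> 2"
    and "0 < q0" and "q0 < p_crit TYPE('n)"
  shows "(\<exists>K>0. \<forall>p q. \<forall>x :: real^'n. 0 < p \<longrightarrow> p < q \<longrightarrow> q \<le> q0 \<longrightarrow>
            time_const p x - time_const q x \<le> K * time_const q x / q * (q - p)) \<and>
         (\<forall>x :: real^'n. \<forall>p0. 0 < p0 \<longrightarrow> p0 \<le> q0 \<longrightarrow>
            (\<exists>L. L-lipschitz_on {p0..q0} (\<lambda>p. time_const p x)))"
proof -
  obtain K where K: "0 < K" and le: "\<And>p q. \<And>x :: real^'n. 0 < p \<Longrightarrow> p \<le> q \<Longrightarrow> q \<le> q0 \<Longrightarrow>
    time_const p x - time_const q x \<le> K * time_const q x / q * (q - p)"
    using time_const_difference[OF assms(2,3)] by blast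
  have "q0 \<le> 1" using exp_lat_difference[OF assms(2,3)] by simp
  \<comment> \<open>The time constant does not increase with the parameter, so
    \<open>time_const q x / q\<close> is largest at q = p0; this gives the Lipschitz
    constant.\<close>
  have "(K * time_const p0 x / p0)-lipschitz_on {p0..q0} (\<lambda>p. time_const p x)"
    if p0: "0 < p0" for x :: "real^'n" and p0
  proof (rule lipschitz_onI)
    have ordered: "dist (time_const p x) (time_const q x) \<le> K * time_const p0 x / p0 * dist p q"
      if pq: "p0 \<le> p" "p \<le> q" "q \<le> q0" for p q
    proof -
      have "time_const q x \<le> time_const p0 x" "time_const q x \<le> time_const p x"
        using pq p0 \<open>q0 \<le> 1\<close> by (auto intro: time_const_antimono)
      moreover have "K * time_const q x / q \<le> K * time_const p0 x / p0"
        using K pq p0 calculation(1) time_const_nonneg[of q x]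
        by (intro frac_le mult_left_mono) auto
      then have "K * time_const q x / q * (q - p) \<le> K * time_const p0 x / p0 * (q - p)"
        using pq by (intro mult_right_mono) auto
      ultimately show ?thesis using le[of p q x] pq p0 by (simp add: dist_real_def)
    qed
    show "dist (time_const p x) (time_const q x) \<le> K * time_const p0 x / p0 * dist p q"
      if "p \<in> {p0..q0}" "q \<in> {p0..q0}" for p q
      using that ordered[of p q] ordered[of q p] by (cases "p \<le> q") (auto simp: dist_commute)
    show "0 \<le> K * time_const p0 x / p0" using K p0 time_const_nonneg[of p0 x] by simp
  qed
  then show ?thesis using K le by (meson less_imp_le)
qed

end
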